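(* Let $m\in\mathbb{N}\setminus\{1\}$, let $0=a_0<a_1<\dots<a_{m-1}<a_m=1$ be real numbers, let $0=b_0<b_1<\dots<b_{m-1}$ with $b_j\in\mathbb{N}$ for all $j=1,\dots,m-1$, and let $$J=\bigcup_{j=0}^{m-1}J_j,\qquad J_j=[a_j+b_j,\,a_{j+1}+b_j).$$ Let $\gamma_j=\frac{a_{j+1}-a_j}{2}$ be half the length of $J_j$. Let $(\delta_n)_{n\in\mathbb{Z}}$ be real numbers with $L:=\sup_n|\delta_n|<\frac14$. If $$\max_{j=1,\dots,m-1}\Big\{B_{\gamma_j}\,\sup_{n\in\mathbb{Z}}\big|\sin\big(\pi\,\mathrm{dist}(\mathbb{Z},\delta_n b_j)\big)\big|\Big\}<\frac{A}{2\sqrt m},$$ where $$A=\cos(\pi L)-\sin(\pi L),\qquad B_{\gamma_j}=2-\cos(\pi\gamma_jL)+\sin(\pi\gamma_jL),$$ then the system $\{e^{2\pi i(n+\delta_n)x}\}_{n\in\mathbb{Z}}$ is a Riesz basis for $L^2(J)$.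
   Context: For real $x$, $\mathrm{dist}(\mathbb{Z},x)=\min_{k\in\mathbb{Z}}|x-k|$. A sequence $\{v_n\}_{n\in\mathbb{Z}}$ in a separable Hilbert space $H$ is a Riesz basis if there are constants $A',B'>0$ such that $A'\sum|c_n|^2\le\|\sum c_nv_n\|^2\le B'\sum|c_n|^2$ for all finite scalar sequences $(c_n)$ and $A'\|w\|^2\le\sum_n|\langle w,v_n\rangle|^2\le B'\|w\|^2$ for all $w\in H$. *)

theory Defs
  imports "HOL-Analysis.Analysis"
begin

text \<open>
  \<open>L\<^sup>2(M)\<close> is modelled by its representatives, i.e. honest square-integrable functions rather than
  classes modulo null sets. All notions below are invariant under a.e. equality, so
  they describe the Hilbert space of classes; \<open>norm_L2\<close> is a seminorm on representatives.
\<close>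

definition space_L2 :: "'a measure \<Rightarrow> ('a \<Rightarrow> complex) set" where
  "space_L2 M = {f \<in> borel_measurable M. integrable M (\<lambda>x. (cmod (f x))\<^sup>2)}"

definition inner_L2 :: "'a measure \<Rightarrow> ('a \<Rightarrow> complex) \<Rightarrow> ('a \<Rightarrow> complex) \<Rightarrow> complex" where
  "inner_L2 M f g = (LINT x|M. f x * cnj (g x))"

definition norm_L2 :: "'a measure \<Rightarrow> ('a \<Rightarrow> complex) \<Rightarrow> real" where
  "norm_L2 M f = sqrt (LINT x|M. (cmod (f x))\<^sup>2)"

lemma inner_L2_self: "inner_L2 M f f = of_real ((norm_L2 M f)\<^sup>2)"
proof -
  have "inner_L2 M f f = (LINT x|M. complex_of_real ((cmod (f x))\<^sup>2))"
    unfolding inner_L2_def by (simp only: complex_norm_square)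
  then show ?thesis
    by (simp only: integral_complex_of_real norm_L2_def) (simp add: integral_nonneg_AE)
qed

text \<open>
  A finite scalar sequence is given by its values \<open>c\<close> on a finite index set \<open>F\<close>.
  Summability is stated explicitly because \<open>infsum\<close> is 0 for non-summable families.
\<close>

definition riesz_basis_L2 :: "'a measure \<Rightarrow> (int \<Rightarrow> 'a \<Rightarrow> complex) \<Rightarrow> bool" where
  "riesz_basis_L2 M v \<longleftrightarrow>
     (\<forall>n. v n \<in> space_L2 M) \<and>
     (\<exists>A' > 0. \<exists>B' > 0.
        (\<forall>F c. finite F \<longrightarrow>
           A' * (\<Sum>n\<in>F. (cmod (c n))\<^sup>2) \<le> (norm_L2 M (\<lambda>x. \<Sum>n\<in>F. c n * v n x))\<^sup>2 \<and>
           (norm_L2 M (\<lambda>x. \<Sum>n\<in>F. c n * v n x))\<^sup>2 \<le> B' * (\<Sum>n\<in>F. (cmod (c n))\<^sup>2)) \<and>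
        (\<forall>w \<in> space_L2 M.
           (\<lambda>n. (cmod (inner_L2 M w (v n)))\<^sup>2) summable_on UNIV \<and>
           A' * (norm_L2 M w)\<^sup>2 \<le> (\<Sum>\<^sub>\<infinity>n. (cmod (inner_L2 M w (v n)))\<^sup>2) \<and>
           (\<Sum>\<^sub>\<infinity>n. (cmod (inner_L2 M w (v n)))\<^sup>2) \<le> B' * (norm_L2 M w)\<^sup>2))"

text \<open>The infimum in \<open>infdist x \<int>\<close> is the minimum of \<open>\<bar>x - k\<bar>\<close> over the integers \<open>k\<close>:\<close>

lemma infdist_Ints_attained:
  fixes x :: real
  shows "\<exists>k::int. infdist x \<int> = \<bar>x - of_int k\<bar>"
proof -
  have "closed (\<int> :: real set)" "(\<int> :: real set) \<noteq> {}"
    by auto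
  then obtain y where "y \<in> (\<int> :: real set)" "infdist x \<int> = dist x y"
    using infdist_attains_inf by blast
  then show ?thesis
    by (auto simp: dist_real_def elim!: Ints_cases)
qed

end

theory Submission
  imports Defs
begin

text \<open>
  The functions \<open>e\<^sub>n(x) = exp (2 \<pi> \<i> n x)\<close> form an orthonormal basis of \<open>L\<^sup>2(J)\<close>, because moving
  the pieces of \<open>J\<close> back by the integers \<open>b\<^sub>j\<close> turns \<open>J\<close> into \<open>[0,1)\<close> and does not change \<open>e\<^sub>n\<close>.
  The given exponentials \<open>v\<^sub>n\<close> are, up to unimodular constants, a perturbation of this basis of
  relative size \<open>q < 1\<close>, and such a perturbation is a Riesz basis
  (\<open>Paley_Wiener_riesz_basis\<close>). All the estimates are made on the side of the coefficients:
  what is bounded is the \<open>\<ell>\<^sup>2\<close> norm of \<open>n \<mapsto> \<langle>w, v\<^sub>n - \<tau>\<^sub>n e\<^sub>n\<rangle>\<close>, over finite sets of indices,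
  by \<open>q \<parallel>w\<parallel>\<close>. Together with Parseval's identity this gives the frame bounds directly, and by
  duality also the bounds for finite linear combinations.

  The perturbation is split in two. Let \<open>E\<^sub>n\<close> be equal to \<open>e\<^sub>n(x) exp (2 \<pi> \<i> \<delta>\<^sub>n (x - b\<^sub>j))\<close> on the
  \<open>j\<close>th piece; this is the exponential \<open>exp (2 \<pi> \<i> (n + \<delta>\<^sub>n) y)\<close> of \<open>[0,1)\<close> transplanted to \<open>J\<close>.

  Kadec's argument compares \<open>E\<^sub>n\<close> with \<open>e\<^sub>n\<close>. It expands \<open>1 - exp (\<i> \<delta> t)\<close>, \<open>\<bar>t\<bar> \<le> \<pi>\<close>, in the functions
  \<open>cos (k t)\<close> and \<open>sin ((k + 1/2) t)\<close>; every term multiplies \<open>w\<close> by a function bounded by \<open>1\<close>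
  and the coefficients by numbers bounded independently of \<open>n\<close>, so Bessel's inequality applies to
  each term, and the bounds add up to \<open>1 - cos (\<pi> L) + sin (\<pi> L) = 1 - A\<close>. Since only the
  boundedness of the phase \<open>t\<close> matters, \<open>Kadec_estimate\<close> is stated for an arbitrary measurable
  \<open>t\<close> on an arbitrary measure space.

  On the \<open>j\<close>th piece, \<open>v\<^sub>n - E\<^sub>n\<close> is \<open>(exp (2 \<pi> \<i> \<delta>\<^sub>n b\<^sub>j) - 1) E\<^sub>n\<close>, whose factor has modulus
  \<open>2 \<bar>sin (\<pi> \<delta>\<^sub>n b\<^sub>j)\<bar> \<le> 2 S\<^sub>j\<close>. Kadec's argument on this piece alone, where the phase is rescaled by
  the length \<open>2 \<gamma>\<^sub>j\<close>, bounds the contribution by \<open>2 S\<^sub>j K\<^sub>j\<close> times the norm of \<open>w\<close> on the piece, with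
  \<open>K\<^sub>j = 2 - cos (2 \<pi> \<gamma>\<^sub>j L) + sin (2 \<pi> \<gamma>\<^sub>j L)\<close>. So the total is at most the square root of
  \<open>\<Sum> (2 S\<^sub>j K\<^sub>j)\<^sup>2\<close>, a sum over \<open>j = 1, \<dots>, m - 1\<close>.

  The constant \<open>K\<^sub>j\<close> is larger than \<open>B\<^sub>\<gamma>\<close> for \<open>\<gamma> = \<gamma>\<^sub>j\<close>, which has half the angle. The gap is closed by
  the absent term \<open>j = 0\<close>: as \<open>K\<^sub>j\<^sup>2 \<le> (1 + 2 \<gamma>\<^sub>j) B\<^sub>\<gamma>\<^sup>2\<close> (\<open>Kadec_constant_half_length\<close>) and
  the lengths \<open>2 \<gamma>\<^sub>j\<close> add up to at most \<open>1\<close>, the \<open>m - 1\<close> terms cost no more than \<open>m\<close> times the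
  maximum of \<open>(2 S\<^sub>j B\<^sub>\<gamma>)\<^sup>2\<close>, which is less than \<open>A\<^sup>2 / m\<close>. Hence \<open>q < (1 - A) + A = 1\<close>.
\<close>

section \<open>The inner product space of square integrable functions\<close>

lemma borel_measurable_cnj [measurable]:
  "f \<in> borel_measurable M \<Longrightarrow> (\<lambda>x. cnj (f x)) \<in> borel_measurable M"
  by (rule borel_measurable_continuous_on[of cnj]) (intro continuous_intros)

lemma space_L2_measurable: "f \<in> space_L2 M \<Longrightarrow> f \<in> borel_measurable M"
  by (simp add: space_L2_def)

lemma space_L2_integrable: "f \<in> space_L2 M \<Longrightarrow> integrable M (\<lambda>x. (cmod (f x))\<^sup>2)"
  by (simp add: space_L2_def)

lemma space_L2_bound:
  assumes "f \<in> borel_measurable M" "integrable M h" "\<And>x. x \<in> space M \<Longrightarrow> (cmod (f x))\<^sup>2 \<le> h x"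
  shows "f \<in> space_L2 M"
proof -
  have "integrable M (\<lambda>x. (cmod (f x))\<^sup>2)"
    using assms(1) by (intro Bochner_Integration.integrable_bound[OF assms(2)]) (auto intro!: AE_I2 dest: assms(3))
  then show ?thesis using assms(1) by (simp add: space_L2_def)
qed

lemma space_L2_mult_bounded:
  assumes "f \<in> space_L2 M" "g \<in> borel_measurable M" "\<And>x. x \<in> space M \<Longrightarrow> cmod (g x) \<le> C"
  shows "(\<lambda>x. f x * g x) \<in> space_L2 M"
proof (rule space_L2_bound[where h = "\<lambda>x. C\<^sup>2 * (cmod (f x))\<^sup>2"])
  show "(\<lambda>x. f x * g x) \<in> borel_measurable M"
    using space_L2_measurable[OF assms(1)] assms(2) by measurable
  show "integrable M (\<lambda>x. C\<^sup>2 * (cmod (f x))\<^sup>2)"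
    using assms(1) by (simp add: space_L2_def)
  show "(cmod (f x * g x))\<^sup>2 \<le> C\<^sup>2 * (cmod (f x))\<^sup>2" if "x \<in> space M" for x
    using assms(3)[OF that] by (simp add: norm_mult power_mult_distrib mult.commute[of "C\<^sup>2"] mult_left_mono power_mono)
qed

lemma space_L2_cmult: "f \<in> space_L2 M \<Longrightarrow> (\<lambda>x. c * f x) \<in> space_L2 M"
  using space_L2_mult_bounded[of f M "\<lambda>_. c" "cmod c"] by (simp add: mult.commute)

lemma space_L2_add:
  assumes "f \<in> space_L2 M" "g \<in> space_L2 M"
  shows "(\<lambda>x. f x + g x) \<in> space_L2 M"
proof (rule space_L2_bound[where h = "\<lambda>x. 2 * (cmod (f x))\<^sup>2 + 2 * (cmod (g x))\<^sup>2"])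
  show "(cmod (f x + g x))\<^sup>2 \<le> 2 * (cmod (f x))\<^sup>2 + 2 * (cmod (g x))\<^sup>2" for x
  proof -
    have "(cmod (f x + g x))\<^sup>2 \<le> (cmod (f x) + cmod (g x))\<^sup>2"
      by (intro power_mono norm_triangle_ineq) auto
    also have "\<dots> \<le> 2 * (cmod (f x))\<^sup>2 + 2 * (cmod (g x))\<^sup>2"
      using zero_le_power2[of "cmod (f x) - cmod (g x)"] by (simp add: power2_eq_square algebra_simps)
    finally show ?thesis .
  qed
  show "(\<lambda>x. f x + g x) \<in> borel_measurable M"
    using assms[THEN space_L2_measurable] by measurable
qed (use assms in \<open>simp add: space_L2_def\<close>)

lemma space_L2_diff:
  assumes "f \<in> space_L2 M" "g \<in> space_L2 M"
  shows "(\<lambda>x. f x - g x) \<in> space_L2 M"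
  using space_L2_add[OF assms(1) space_L2_cmult[OF assms(2), of "-1"]] by simp

lemma space_L2_zero: "(\<lambda>x. 0) \<in> space_L2 M"
  by (simp add: space_L2_def)

lemma space_L2_sum:
  "(\<And>i. i \<in> F \<Longrightarrow> f i \<in> space_L2 M) \<Longrightarrow> (\<lambda>x. \<Sum>i\<in>F. f i x) \<in> space_L2 M"
  by (induction F rule: infinite_finite_induct) (auto simp: space_L2_zero intro: space_L2_add)

lemma integrable_L2_norm_mult:
  assumes "f \<in> space_L2 M" "g \<in> space_L2 M"
  shows "integrable M (\<lambda>x. cmod (f x) * cmod (g x))"
proof (rule Bochner_Integration.integrable_bound)
  show "integrable M (\<lambda>x. (cmod (f x))\<^sup>2 + (cmod (g x))\<^sup>2)"
    using assms by (simp add: space_L2_def)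
  show "(\<lambda>x. cmod (f x) * cmod (g x)) \<in> borel_measurable M"
    using assms[THEN space_L2_measurable] by measurable
  have "cmod (f x) * cmod (g x) \<le> (cmod (f x))\<^sup>2 + (cmod (g x))\<^sup>2" for x
    using zero_le_power2[of "cmod (f x) - cmod (g x)"] mult_nonneg_nonneg[OF norm_ge_zero norm_ge_zero, of "f x" "g x"]
    unfolding power2_diff by linarith
  then show "AE x in M. norm (cmod (f x) * cmod (g x)) \<le> norm ((cmod (f x))\<^sup>2 + (cmod (g x))\<^sup>2)"
    by (intro AE_I2) (simp add: abs_of_nonneg)
qed

lemma integrable_inner_L2:
  assumes "f \<in> space_L2 M" "g \<in> space_L2 M"
  shows "integrable M (\<lambda>x. f x * cnj (g x))"
proof (rule Bochner_Integration.integrable_bound[OF integrable_L2_norm_mult[OF assms]])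
  show "(\<lambda>x. f x * cnj (g x)) \<in> borel_measurable M"
    using assms[THEN space_L2_measurable] by measurable
qed (simp add: norm_mult)

lemma inner_L2_add_left:
  assumes "f \<in> space_L2 M" "g \<in> space_L2 M" "h \<in> space_L2 M"
  shows "inner_L2 M (\<lambda>x. f x + g x) h = inner_L2 M f h + inner_L2 M g h"
  unfolding inner_L2_def distrib_right using assms
  by (intro Bochner_Integration.integral_add integrable_inner_L2)

lemma inner_L2_diff_left:
  assumes "f \<in> space_L2 M" "g \<in> space_L2 M" "h \<in> space_L2 M"
  shows "inner_L2 M (\<lambda>x. f x - g x) h = inner_L2 M f h - inner_L2 M g h"
  unfolding inner_L2_def left_diff_distrib using assms
  by (intro Bochner_Integration.integral_diff integrable_inner_L2)

lemma inner_L2_cmult_left: "inner_L2 M (\<lambda>x. c * f x) h = c * inner_L2 M f h"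
  unfolding inner_L2_def by (simp add: mult.assoc)

lemma inner_L2_sum_left:
  assumes "\<And>i. i \<in> F \<Longrightarrow> f i \<in> space_L2 M" "h \<in> space_L2 M"
  shows "inner_L2 M (\<lambda>x. \<Sum>i\<in>F. f i x) h = (\<Sum>i\<in>F. inner_L2 M (f i) h)"
  unfolding inner_L2_def sum_distrib_right using assms
  by (intro Bochner_Integration.integral_sum integrable_inner_L2)

lemma inner_L2_cnj: "inner_L2 M g f = cnj (inner_L2 M f g)"
proof -
  have "cnj (inner_L2 M f g) = (LINT x|M. cnj (f x * cnj (g x)))"
    unfolding inner_L2_def by (simp only: Bochner_Integration.integral_cnj)
  then show ?thesis by (simp add: inner_L2_def mult.commute)
qed

lemma inner_L2_add_right:
  assumes "f \<in> space_L2 M" "g \<in> space_L2 M" "h \<in> space_L2 M"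
  shows "inner_L2 M h (\<lambda>x. f x + g x) = inner_L2 M h f + inner_L2 M h g"
  using inner_L2_add_left[OF assms] by (metis complex_cnj_add inner_L2_cnj)

lemma inner_L2_diff_right:
  assumes "f \<in> space_L2 M" "g \<in> space_L2 M" "h \<in> space_L2 M"
  shows "inner_L2 M h (\<lambda>x. f x - g x) = inner_L2 M h f - inner_L2 M h g"
  using inner_L2_diff_left[OF assms] by (metis complex_cnj_diff inner_L2_cnj)

lemma inner_L2_cmult_right: "inner_L2 M h (\<lambda>x. c * f x) = cnj c * inner_L2 M h f"
  by (metis complex_cnj_mult inner_L2_cnj inner_L2_cmult_left)

lemma inner_L2_sum_right:
  assumes "\<And>i. i \<in> F \<Longrightarrow> f i \<in> space_L2 M" "h \<in> space_L2 M"
  shows "inner_L2 M h (\<lambda>x. \<Sum>i\<in>F. f i x) = (\<Sum>i\<in>F. inner_L2 M h (f i))"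
proof -
  have "inner_L2 M h (\<lambda>x. \<Sum>i\<in>F. f i x) = cnj (\<Sum>i\<in>F. inner_L2 M (f i) h)"
    by (subst inner_L2_cnj) (simp add: inner_L2_sum_left[OF assms])
  also have "\<dots> = (\<Sum>i\<in>F. inner_L2 M h (f i))"
    unfolding cnj_sum by (intro sum.cong refl) (rule inner_L2_cnj[symmetric])
  finally show ?thesis .
qed

lemma norm_L2_nonneg [simp]: "0 \<le> norm_L2 M f"
  by (simp add: norm_L2_def)

lemma norm_L2_sq: "(norm_L2 M f)\<^sup>2 = (LINT x|M. (cmod (f x))\<^sup>2)"
  by (simp add: norm_L2_def)

text \<open>
  The pointwise inequality \<open>2 u v \<le> s u\<^sup>2 + v\<^sup>2 / s\<close> is integrated and then optimised in \<open>s\<close>. The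
  optimal \<open>s\<close> is the quotient of the two norms; adding a small \<open>r\<close> to both norms keeps it defined
  and positive when a norm vanishes.
\<close>

lemma Cauchy_Schwarz_L2:
  assumes "f \<in> space_L2 M" "g \<in> space_L2 M"
  shows "cmod (inner_L2 M f g) \<le> norm_L2 M f * norm_L2 M g"
proof -
  let ?F = "norm_L2 M f" and ?G = "norm_L2 M g"
  define P where "P = (LINT x|M. cmod (f x) * cmod (g x))"
  have "cmod (inner_L2 M f g) \<le> P"
    unfolding inner_L2_def P_def
    using integral_norm_bound[of M "\<lambda>x. f x * cnj (g x)"] by (simp add: norm_mult)
  moreover have scaled: "2 * P \<le> s * ?F\<^sup>2 + ?G\<^sup>2 / s" if "s > 0" for s
  proof -
    have "2 * (cmod (f x) * cmod (g x)) \<le> s * (cmod (f x))\<^sup>2 + (cmod (g x))\<^sup>2 / s" for x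
    proof -
      have "0 \<le> (s * cmod (f x) - cmod (g x))\<^sup>2 / s" using that by simp
      also have "\<dots> = s * (cmod (f x))\<^sup>2 + (cmod (g x))\<^sup>2 / s - 2 * (cmod (f x) * cmod (g x))"
        using that by (simp add: power2_eq_square field_simps)
      finally show ?thesis by simp
    qed
    then have "(LINT x|M. 2 * (cmod (f x) * cmod (g x)))
        \<le> (LINT x|M. s * (cmod (f x))\<^sup>2 + (cmod (g x))\<^sup>2 / s)"
      using assms by (intro integral_mono)
        (auto intro!: integrable_L2_norm_mult Bochner_Integration.integrable_add simp: space_L2_integrable)
    then show ?thesis
      using assms by (simp add: P_def norm_L2_sq space_L2_integrable)
  qed
  moreover have "P \<le> ?F * ?G"
  proof (rule field_le_epsilon)
    fix e :: real assume "e > 0"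
    define r where "r = e / (?F + ?G + 1)"
    have r: "r > 0" unfolding r_def using \<open>e > 0\<close> by (intro divide_pos_pos add_nonneg_pos) auto
    have "2 * P \<le> (?G + r) / (?F + r) * ?F\<^sup>2 + ?G\<^sup>2 / ((?G + r) / (?F + r))"
      using r by (intro scaled divide_pos_pos add_nonneg_pos) auto
    also have "(?G + r) / (?F + r) * ?F\<^sup>2 \<le> (?G + r) * ?F"
    proof -
      have "?F / (?F + r) \<le> 1" using r by (intro divide_le_eq_1_pos[THEN iffD2] add_nonneg_pos) auto
      then have "(?G + r) * ?F * (?F / (?F + r)) \<le> (?G + r) * ?F * 1"
        using r by (intro mult_left_mono) auto
      then show ?thesis by (simp add: power2_eq_square mult.assoc)
    qed
    also have "?G\<^sup>2 / ((?G + r) / (?F + r)) \<le> (?F + r) * ?G"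
    proof -
      have "?G / (?G + r) \<le> 1" using r by (intro divide_le_eq_1_pos[THEN iffD2] add_nonneg_pos) auto
      then have "(?F + r) * ?G * (?G / (?G + r)) \<le> (?F + r) * ?G * 1"
        using r by (intro mult_left_mono) auto
      then show ?thesis by (simp add: power2_eq_square mult_ac)
    qed
    finally have "2 * P \<le> 2 * (?F * ?G) + r * (?F + ?G)" by (simp add: algebra_simps)
    also have "r * (?F + ?G) \<le> e"
    proof -
      have "r * (?F + ?G) \<le> r * (?F + ?G + 1)" using r by simp
      also have "\<dots> = e" unfolding r_def using add_nonneg_pos[OF add_nonneg_nonneg[OF norm_L2_nonneg norm_L2_nonneg] zero_less_one, of M f M g]
        by simp
      finally show ?thesis .
    qed
    finally show "P \<le> ?F * ?G + e" using \<open>e > 0\<close> by simp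
  qed
  ultimately show ?thesis by simp
qed

lemma norm_L2_add_sq:
  assumes "f \<in> space_L2 M" "g \<in> space_L2 M"
  shows "(norm_L2 M (\<lambda>x. f x + g x))\<^sup>2 = (norm_L2 M f)\<^sup>2 + (norm_L2 M g)\<^sup>2 + 2 * Re (inner_L2 M f g)"
proof -
  have "inner_L2 M (\<lambda>x. f x + g x) (\<lambda>x. f x + g x)
      = inner_L2 M f f + inner_L2 M g g + (inner_L2 M f g + cnj (inner_L2 M f g))"
    using assms by (simp add: inner_L2_add_left inner_L2_add_right space_L2_add inner_L2_cnj[of M g f])
  then have "complex_of_real ((norm_L2 M (\<lambda>x. f x + g x))\<^sup>2)
     = complex_of_real ((norm_L2 M f)\<^sup>2 + (norm_L2 M g)\<^sup>2 + 2 * Re (inner_L2 M f g))"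
    unfolding inner_L2_self complex_add_cnj by simp
  then show ?thesis using of_real_eq_iff by blast
qed

lemma norm_L2_triangle:
  assumes "f \<in> space_L2 M" "g \<in> space_L2 M"
  shows "norm_L2 M (\<lambda>x. f x + g x) \<le> norm_L2 M f + norm_L2 M g"
proof (rule power2_le_imp_le)
  have "Re (inner_L2 M f g) \<le> norm_L2 M f * norm_L2 M g"
    using Cauchy_Schwarz_L2[OF assms] complex_Re_le_cmod order_trans by blast
  then show "(norm_L2 M (\<lambda>x. f x + g x))\<^sup>2 \<le> (norm_L2 M f + norm_L2 M g)\<^sup>2"
    by (simp add: norm_L2_add_sq[OF assms] power2_sum)
qed auto

lemma norm_L2_cmult: "norm_L2 M (\<lambda>x. c * f x) = cmod c * norm_L2 M f"
  by (simp add: norm_L2_def norm_mult power_mult_distrib real_sqrt_mult)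

lemma norm_L2_mono:
  assumes "f \<in> space_L2 M" "g \<in> borel_measurable M" "\<And>x. x \<in> space M \<Longrightarrow> cmod (g x) \<le> cmod (f x)"
  shows "norm_L2 M g \<le> norm_L2 M f"
proof -
  have "g \<in> space_L2 M"
    using assms by (intro space_L2_bound[of _ _ "\<lambda>x. (cmod (f x))\<^sup>2"]) (auto simp: space_L2_integrable power_mono)
  then show ?thesis unfolding norm_L2_def using assms
    by (intro real_sqrt_le_mono integral_mono) (auto simp: space_L2_integrable power_mono)
qed

section \<open>Orthonormal systems and trigonometric polynomials\<close>

definition orthonormal_L2 :: "'a measure \<Rightarrow> ('i \<Rightarrow> 'a \<Rightarrow> complex) \<Rightarrow> bool" where
  "orthonormal_L2 M e \<longleftrightarrow> (\<forall>n. e n \<in> space_L2 M) \<and>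
     (\<forall>m n. inner_L2 M (e m) (e n) = (if m = n then 1 else 0))"

text \<open>
  Completeness of a system, expressed by finite sums only. For an orthonormal system Bessel's
  inequality gives the reverse bound, so that this is Parseval's identity.
\<close>

definition parseval_L2 :: "'a measure \<Rightarrow> ('i \<Rightarrow> 'a \<Rightarrow> complex) \<Rightarrow> bool" where
  "parseval_L2 M e \<longleftrightarrow> (\<forall>w \<in> space_L2 M. \<forall>\<epsilon>>0. \<exists>F. finite F \<and>
     (norm_L2 M w)\<^sup>2 - \<epsilon> \<le> (\<Sum>n\<in>F. (cmod (inner_L2 M w (e n)))\<^sup>2))"

lemma orthonormal_space: "orthonormal_L2 M e \<Longrightarrow> e n \<in> space_L2 M"
  by (simp add: orthonormal_L2_def)

lemma orthonormal_inner_sum: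
  assumes "orthonormal_L2 M e" "finite F"
  shows "inner_L2 M (\<lambda>x. \<Sum>n\<in>F. c n * e n x) (\<lambda>x. \<Sum>n\<in>F. d n * e n x) = (\<Sum>n\<in>F. c n * cnj (d n))"
proof -
  have e: "e n \<in> space_L2 M" "(\<lambda>x. c n * e n x) \<in> space_L2 M" "(\<lambda>x. d n * e n x) \<in> space_L2 M" 
    "(\<lambda>x. \<Sum>n\<in>F. d n * e n x) \<in> space_L2 M" for n
    by (intro space_L2_sum space_L2_cmult orthonormal_space[OF assms(1)])+
  have "inner_L2 M (\<lambda>x. \<Sum>n\<in>F. c n * e n x) (\<lambda>x. \<Sum>n\<in>F. d n * e n x)
      = (\<Sum>n\<in>F. c n * (\<Sum>m\<in>F. cnj (d m) * inner_L2 M (e n) (e m)))"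
    using e by (simp add: inner_L2_sum_left inner_L2_sum_right inner_L2_cmult_left inner_L2_cmult_right)
  also have "\<dots> = (\<Sum>n\<in>F. c n * cnj (d n))"
  proof (intro sum.cong refl)
    fix n assume "n \<in> F"
    have "(\<Sum>m\<in>F. cnj (d m) * inner_L2 M (e n) (e m)) = (\<Sum>m\<in>F. if n = m then cnj (d m) else 0)"
      using assms(1) unfolding orthonormal_L2_def by (intro sum.cong refl) auto
    then show "c n * (\<Sum>m\<in>F. cnj (d m) * inner_L2 M (e n) (e m)) = c n * cnj (d n)"
      using \<open>n \<in> F\<close> assms(2) by simp
  qed
  finally show ?thesis .
qed

lemma norm_orthonormal_sum:
  assumes "orthonormal_L2 M e" "finite F"
  shows "(norm_L2 M (\<lambda>x. \<Sum>n\<in>F. c n * e n x))\<^sup>2 = (\<Sum>n\<in>F. (cmod (c n))\<^sup>2)"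
proof -
  have "complex_of_real ((norm_L2 M (\<lambda>x. \<Sum>n\<in>F. c n * e n x))\<^sup>2)
      = complex_of_real (\<Sum>n\<in>F. (cmod (c n))\<^sup>2)"
    unfolding inner_L2_self[symmetric] orthonormal_inner_sum[OF assms] of_real_sum complex_norm_square ..
  then show ?thesis using of_real_eq_iff by blast
qed

text \<open>
  Completing the square. The choice of Fourier coefficients for \<open>c\<close> gives Bessel's inequality, and
  an arbitrary choice shows that a good approximation of \<open>w\<close> forces the Fourier coefficients
  to carry almost all of its norm.
\<close>

lemma norm_diff_orthonormal_sum:
  assumes "orthonormal_L2 M e" "finite F" "w \<in> space_L2 M"
  shows "(norm_L2 M (\<lambda>x. w x - (\<Sum>n\<in>F. c n * e n x)))\<^sup>2 + (\<Sum>n\<in>F. (cmod (inner_L2 M w (e n)))\<^sup>2)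
     = (norm_L2 M w)\<^sup>2 + (\<Sum>n\<in>F. (cmod (c n - inner_L2 M w (e n)))\<^sup>2)"
proof -
  let ?p = "\<lambda>x. \<Sum>n\<in>F. (- c n) * e n x" and ?i = "\<lambda>n. inner_L2 M w (e n)"
  have e: "e n \<in> space_L2 M" "(\<lambda>x. (- c n) * e n x) \<in> space_L2 M" for n
    by (intro space_L2_cmult orthonormal_space[OF assms(1)])+
  have p: "?p \<in> space_L2 M" using e(2) by (intro space_L2_sum)
  have "inner_L2 M w ?p = (\<Sum>n\<in>F. cnj (- c n) * ?i n)"
    using e assms(3) by (subst inner_L2_sum_right) (simp_all only: inner_L2_cmult_right)
  then have "(norm_L2 M (\<lambda>x. w x + ?p x))\<^sup>2
     = (norm_L2 M w)\<^sup>2 + (\<Sum>n\<in>F. (cmod (c n))\<^sup>2) - 2 * Re (\<Sum>n\<in>F. cnj (c n) * ?i n)"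
    unfolding norm_L2_add_sq[OF assms(3) p] norm_orthonormal_sum[OF assms(1,2)]
    by (simp add: sum_negf)
  moreover have "(cmod (c n - ?i n))\<^sup>2 = (cmod (c n))\<^sup>2 + (cmod (?i n))\<^sup>2 - 2 * Re (cnj (c n) * ?i n)" for n
    unfolding cmod_power2 by (simp add: power2_eq_square algebra_simps)
  ultimately show ?thesis
    by (simp add: sum.distrib sum_subtractf sum_distrib_left sum_negf)
qed

lemma Bessel_inequality:
  assumes "orthonormal_L2 M e" "finite F" "w \<in> space_L2 M"
  shows "(\<Sum>n\<in>F. (cmod (inner_L2 M w (e n)))\<^sup>2) \<le> (norm_L2 M w)\<^sup>2"
proof -
  let ?r = "norm_L2 M (\<lambda>x. w x - (\<Sum>n\<in>F. inner_L2 M w (e n) * e n x))"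
  have "?r\<^sup>2 + (\<Sum>n\<in>F. (cmod (inner_L2 M w (e n)))\<^sup>2) = (norm_L2 M w)\<^sup>2"
    using norm_diff_orthonormal_sum[OF assms, of "\<lambda>n. inner_L2 M w (e n)"] by simp
  then show ?thesis using zero_le_power2[of ?r] by linarith
qed

definition harmonic :: "int \<Rightarrow> real \<Rightarrow> complex" where
  "harmonic n x = cis (2 * pi * of_int n * x)"

inductive trig_poly :: "(real \<Rightarrow> complex) \<Rightarrow> bool" where
  harmonic: "trig_poly (harmonic n)"
| cmult: "trig_poly p \<Longrightarrow> trig_poly (\<lambda>x. c * p x)"
| add: "trig_poly p \<Longrightarrow> trig_poly q \<Longrightarrow> trig_poly (\<lambda>x. p x + q x)"

lemma trig_poly_const: "trig_poly (\<lambda>x. c)"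
  using trig_poly.cmult[OF trig_poly.harmonic[of 0], of c] by (simp add: harmonic_def)

lemma trig_poly_harmonic_mult: "trig_poly q \<Longrightarrow> trig_poly (\<lambda>x. harmonic n x * q x)"
proof (induction rule: trig_poly.induct)
  case (harmonic m)
  have "(\<lambda>x. harmonic n x * harmonic m x) = harmonic (n + m)"
    by (simp add: harmonic_def cis_mult fun_eq_iff algebra_simps)
  then show ?case by (simp add: trig_poly.harmonic)
next
  case (cmult p c)
  then show ?case using trig_poly.cmult[OF cmult.IH, of c] by (simp add: mult_ac)
next
  case (add p q)
  then show ?case using trig_poly.add[OF add.IH] by (simp add: distrib_left)
qed

lemma trig_poly_mult: "trig_poly p \<Longrightarrow> trig_poly q \<Longrightarrow> trig_poly (\<lambda>x. p x * q x)"
proof (induction rule: trig_poly.induct)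
  case (harmonic n)
  then show ?case by (rule trig_poly_harmonic_mult)
next
  case (cmult p c)
  then show ?case using trig_poly.cmult[of "\<lambda>x. p x * q x" c] by (simp add: mult_ac)
next
  case (add p r)
  then show ?case using trig_poly.add[of "\<lambda>x. p x * q x" "\<lambda>x. r x * q x"] by (simp add: distrib_right)
qed

lemma trig_poly_finite_sum:
  assumes "trig_poly p"
  shows "\<exists>F c. finite F \<and> p = (\<lambda>x. \<Sum>n\<in>F. c n * harmonic n x)"
  using assms
proof (induction rule: trig_poly.induct)
  case (harmonic n)
  show ?case by (rule exI[of _ "{n}"], rule exI[of _ "\<lambda>_. 1"]) auto
next
  case (cmult p c)
  then obtain F d where "finite F" "p = (\<lambda>x. \<Sum>n\<in>F. d n * harmonic n x)" by blast
  then show ?case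
    by (intro exI[of _ F] exI[of _ "\<lambda>n. c * d n"]) (simp add: sum_distrib_left mult.assoc)
next
  case (add p q)
  then obtain F c G d where *: "finite F" "p = (\<lambda>x. \<Sum>n\<in>F. c n * harmonic n x)"
    "finite G" "q = (\<lambda>x. \<Sum>n\<in>G. d n * harmonic n x)" by blast
  have "p x + q x = (\<Sum>n\<in>F \<union> G. ((if n \<in> F then c n else 0) + (if n \<in> G then d n else 0)) * harmonic n x)" for x
  proof -
    have "(\<Sum>n\<in>F. c n * harmonic n x) = (\<Sum>n\<in>F \<union> G. (if n \<in> F then c n else 0) * harmonic n x)"
      using * by (intro sum.mono_neutral_cong_left) auto
    moreover have "(\<Sum>n\<in>G. d n * harmonic n x) = (\<Sum>n\<in>F \<union> G. (if n \<in> G then d n else 0) * harmonic n x)"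
      using * by (intro sum.mono_neutral_cong_left) auto
    ultimately show ?thesis using * by (simp add: distrib_right sum.distrib)
  qed
  then show ?case using * by (intro exI[of _ "F \<union> G"] exI) (auto simp: fun_eq_iff)
qed

text \<open>
  On the unit circle the real and the imaginary part are trigonometric polynomials, and these are
  closed under products; so polynomial approximation on the circle is trigonometric approximation.
\<close>

lemma trig_poly_real_polynomial:
  "real_polynomial_function p \<Longrightarrow> trig_poly (\<lambda>x. of_real (p (cis (2 * pi * x))))"
proof (induction rule: real_polynomial_function.induct)
  case (linear f)
  interpret bounded_linear f by fact
  have "complex_of_real (f (cis (2 * pi * x)))
      = (of_real (f 1) / 2 - \<i> * of_real (f \<i>) / 2) * harmonic 1 x
       + (of_real (f 1) / 2 + \<i> * of_real (f \<i>) / 2) * harmonic (-1) x" for x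
  proof -
    have "f (cis (2 * pi * x)) = f (cos (2 * pi * x) *\<^sub>R 1 + sin (2 * pi * x) *\<^sub>R \<i>)"
      by (rule arg_cong[of _ _ f]) (simp add: complex_eq_iff)
    also have "\<dots> = cos (2 * pi * x) * f 1 + sin (2 * pi * x) * f \<i>"
      by (simp add: add scaleR)
    finally show ?thesis by (simp add: harmonic_def complex_eq_iff field_simps)
  qed
  then show ?case by (auto intro!: trig_poly.intros)
next
  case (const c)
  then show ?case by (simp add: trig_poly_const)
next
  case (add f g)
  then show ?case using trig_poly.add by simp
next
  case (mult f g)
  then show ?case using trig_poly_mult by simp
qed

lemma trig_poly_polynomial:
  fixes p :: "complex \<Rightarrow> complex"
  assumes "polynomial_function p"
  shows "trig_poly (\<lambda>x. p (cis (2 * pi * x)))"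
proof -
  have "real_polynomial_function (\<lambda>z. Re (p z))" "real_polynomial_function (\<lambda>z. Im (p z))"
    using assms bounded_linear_Re bounded_linear_Im unfolding polynomial_function_def o_def by blast+
  then have "trig_poly (\<lambda>x. of_real (Re (p (cis (2 * pi * x)))) + \<i> * of_real (Im (p (cis (2 * pi * x)))))"
    by (intro trig_poly.add trig_poly.cmult trig_poly_real_polynomial)
  then show ?thesis by (simp flip: complex_eq)
qed

text \<open>
  A continuous function on the line need not be periodic. The damping factor \<open>min 1 (k \<bar>1 - z\<bar>)\<close>, with
  \<open>z = exp (2 \<pi> \<i> x)\<close>, vanishes at the point \<open>z = 1\<close> where the argument jumps; the damped function is
  therefore continuous on the circle and the Stone--Weierstrass theorem applies to it.
\<close>

lemma trig_poly_approx_damped: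
  fixes g :: "real \<Rightarrow> complex"
  assumes g: "continuous_on UNIV g" and C: "\<And>x. cmod (g x) \<le> C" and "\<epsilon> > 0"
  shows "\<exists>p. trig_poly p \<and>
    (\<forall>x\<in>{0..<1}. cmod (g x * of_real (min 1 (k * cmod (1 - cis (2 * pi * x)))) - p x) < \<epsilon>)"
proof -
  define r where "r = (\<lambda>z. complex_of_real (min 1 (k * cmod (1 - z))))"
  define F where "F = (\<lambda>z. g (Arg2pi z / (2 * pi)) * r z)"
  have r: "isCont r z" for z unfolding r_def by (intro continuous_intros)
  have "isCont F z" if "cmod z = 1" for z
  proof (cases "z \<in> \<real>\<^sub>\<ge>\<^sub>0")
    case False
    then have "isCont Arg2pi z" by (rule continuous_at_Arg2pi)
    moreover have "isCont g x" for x using g by (simp add: continuous_on_eq_continuous_at)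
    ultimately show ?thesis unfolding F_def
      by (intro continuous_intros r isCont_o2[of z "\<lambda>z. Arg2pi z / (2 * pi)" g]) auto
  next
    case True
    then have [simp]: "z = 1" using that by (auto elim!: nonneg_Reals_cases)
    have "(\<lambda>z. C * cmod (r z)) \<midarrow>1\<rightarrow> C * cmod (r 1)"
      using r[of 1] unfolding isCont_def by (intro tendsto_intros)
    then have "(\<lambda>z. C * cmod (r z)) \<midarrow>1\<rightarrow> 0" by (simp add: r_def)
    moreover have "\<forall>\<^sub>F z in at 1. norm (F z) \<le> C * cmod (r z)"
      by (simp add: F_def norm_mult mult_right_mono C)
    ultimately have "F \<midarrow>1\<rightarrow> 0" by (rule Lim_null_comparison[rotated])
    moreover have "F 1 = 0" by (simp add: F_def r_def)
    ultimately show ?thesis by (simp add: isCont_def)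
  qed
  then have "continuous_on (sphere 0 1) F"
    by (intro continuous_at_imp_continuous_on) auto
  then obtain q where q: "polynomial_function q" "\<And>z. z \<in> sphere 0 1 \<Longrightarrow> cmod (F z - q z) < \<epsilon>"
    using Stone_Weierstrass_polynomial_function[of "sphere 0 1" F \<epsilon>] \<open>\<epsilon> > 0\<close> by auto
  show ?thesis
  proof (intro exI conjI ballI)
    show "trig_poly (\<lambda>x. q (cis (2 * pi * x)))" using q(1) by (rule trig_poly_polynomial)
    fix x :: real assume "x \<in> {0..<1}"
    then have "Arg2pi (cis (2 * pi * x)) = 2 * pi * x"
      unfolding cis_conv_exp by (subst Arg2pi_exp) auto
    then have "F (cis (2 * pi * x)) = g x * of_real (min 1 (k * cmod (1 - cis (2 * pi * x))))"
      by (simp add: F_def r_def)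
    then show "cmod (g x * of_real (min 1 (k * cmod (1 - cis (2 * pi * x)))) - q (cis (2 * pi * x))) < \<epsilon>"
      using q(2)[of "cis (2 * pi * x)"] by simp
  qed
qed

section \<open>Density of trigonometric polynomials\<close>

abbreviation unit_M :: "real measure" where "unit_M \<equiv> lebesgue_on {0..<1}"

lemma finite_measure_unit: "finite_measure unit_M"
  by (rule finite_measure_lebesgue_on) (rule bounded_set_imp_lmeasurable, auto)

lemma measure_unit_M: "measure unit_M (space unit_M) = 1"
proof -
  have "measure unit_M (space unit_M) = measure lebesgue {0..<1::real}"
    by (simp only: space_lebesgue_on) (rule measure_restrict_space, auto)
  also have "\<dots> = measure lborel {0..<1::real}" by (rule measure_completion) simp
  finally show ?thesis by simp
qed

lemma continuous_measurable_lebesgue_on: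
  fixes f :: "real \<Rightarrow> complex"
  assumes "continuous_on S f" "S \<in> sets lebesgue"
  shows "f \<in> borel_measurable (lebesgue_on S)"
  using assms by (rule continuous_imp_measurable_on_sets_lebesgue)

lemma space_L2_unit_bounded:
  assumes "f \<in> borel_measurable unit_M" "\<And>x. x \<in> {0..<1} \<Longrightarrow> cmod (f x) \<le> C"
  shows "f \<in> space_L2 unit_M"
proof (rule space_L2_bound[where h = "\<lambda>_. C\<^sup>2"])
  interpret finite_measure unit_M by (rule finite_measure_unit)
  show "integrable unit_M (\<lambda>_. C\<^sup>2)" by simp
qed (use assms in \<open>auto intro: power_mono\<close>)

lemma norm_L2_unit_bounded:
  assumes "f \<in> borel_measurable unit_M" "\<And>x. x \<in> {0..<1} \<Longrightarrow> cmod (f x) \<le> C" "0 \<le> C"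
  shows "norm_L2 unit_M f \<le> C"
proof -
  interpret finite_measure unit_M by (rule finite_measure_unit)
  have "(norm_L2 unit_M f)\<^sup>2 \<le> (LINT x|unit_M. C\<^sup>2)"
    unfolding norm_L2_sq using assms 
    by (intro integral_mono space_L2_integrable space_L2_unit_bounded) (auto intro: power_mono)
  also have "\<dots> = C\<^sup>2" using measure_unit_M by simp
  finally show ?thesis using assms(3) by (rule power2_le_imp_le)
qed

lemma harmonic_measurable: "S \<in> sets lebesgue \<Longrightarrow> harmonic n \<in> borel_measurable (lebesgue_on S)"
  unfolding harmonic_def by (intro continuous_measurable_lebesgue_on continuous_intros)

lemma trig_poly_measurable: "trig_poly p \<Longrightarrow> S \<in> sets lebesgue \<Longrightarrow> p \<in> borel_measurable (lebesgue_on S)"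
  by (induction rule: trig_poly.induct) (auto intro: harmonic_measurable)

lemma norm_harmonic [simp]: "cmod (harmonic n x) = 1"
  by (simp add: harmonic_def)

lemma harmonic_space: "harmonic n \<in> space_L2 unit_M"
  by (rule space_L2_unit_bounded[of _ 1]) (auto intro: harmonic_measurable)

lemma trig_poly_space: "trig_poly p \<Longrightarrow> p \<in> space_L2 unit_M"
  by (induction rule: trig_poly.induct) (auto intro: harmonic_space space_L2_cmult space_L2_add)

definition trig_limit :: "(real \<Rightarrow> complex) \<Rightarrow> bool" where
  "trig_limit f \<longleftrightarrow> f \<in> space_L2 unit_M \<and>
     (\<forall>\<epsilon>>0. \<exists>p. trig_poly p \<and> norm_L2 unit_M (\<lambda>x. f x - p x) < \<epsilon>)"

text \<open>
  This closure property carries the density of trigonometric polynomials from one class of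
  functions to a larger one.
\<close>

lemma trig_limit_dominated:
  fixes f :: "real \<Rightarrow> complex" and g :: "nat \<Rightarrow> real \<Rightarrow> complex"
  assumes g: "\<And>n. trig_limit (g n)" and f: "f \<in> space_L2 unit_M"
    and lim: "AE x in unit_M. (\<lambda>n. g n x) \<longlonglongrightarrow> f x"
    and h: "integrable unit_M h" and bound: "\<And>n x. (cmod (f x - g n x))\<^sup>2 \<le> h x"
  shows "trig_limit f"
  unfolding trig_limit_def
proof (intro conjI allI impI f)
  fix \<epsilon> :: real assume "\<epsilon> > 0"
  have gs: "g n \<in> space_L2 unit_M" for n using g by (simp add: trig_limit_def)
  have "(\<lambda>n. LINT x|unit_M. (cmod (f x - g n x))\<^sup>2) \<longlonglongrightarrow> (LINT x|unit_M. 0)"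
  proof (rule integral_dominated_convergence[OF _ _ h])
    show "(\<lambda>x. (cmod (f x - g n x))\<^sup>2) \<in> borel_measurable unit_M" for n
      using space_L2_measurable[OF f] space_L2_measurable[OF gs[of n]] by measurable
    show "AE x in unit_M. (\<lambda>n. (cmod (f x - g n x))\<^sup>2) \<longlonglongrightarrow> 0"
      using lim
    proof eventually_elim
      case (elim x)
      then have "(\<lambda>n. (cmod (f x - g n x))\<^sup>2) \<longlonglongrightarrow> (cmod (f x - f x))\<^sup>2"
        by (intro tendsto_intros)
      then show ?case by simp
    qed
  qed (auto simp: bound)
  then have "\<forall>\<^sub>F n in sequentially. (norm_L2 unit_M (\<lambda>x. f x - g n x))\<^sup>2 < (\<epsilon>/2)\<^sup>2"
    unfolding norm_L2_sq using \<open>\<epsilon> > 0\<close> by (intro order_tendstoD(2)) auto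
  then obtain n where n: "(norm_L2 unit_M (\<lambda>x. f x - g n x))\<^sup>2 < (\<epsilon>/2)\<^sup>2"
    by (auto simp: eventually_sequentially)
  then have n: "norm_L2 unit_M (\<lambda>x. f x - g n x) < \<epsilon>/2"
    using \<open>\<epsilon> > 0\<close> by (intro power2_less_imp_less[OF n]) auto
  obtain p where p: "trig_poly p" "norm_L2 unit_M (\<lambda>x. g n x - p x) < \<epsilon>/2"
    using g[of n] \<open>\<epsilon> > 0\<close> unfolding trig_limit_def by (meson half_gt_zero)
  have "norm_L2 unit_M (\<lambda>x. f x - p x) \<le> norm_L2 unit_M (\<lambda>x. f x - g n x) + norm_L2 unit_M (\<lambda>x. g n x - p x)"
    using norm_L2_triangle[of "\<lambda>x. f x - g n x" unit_M "\<lambda>x. g n x - p x"] f gs p(1)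
    by (simp add: space_L2_diff trig_poly_space)
  then show "\<exists>p. trig_poly p \<and> norm_L2 unit_M (\<lambda>x. f x - p x) < \<epsilon>"
    using n p by (intro exI[of _ p]) auto
qed

text \<open>
  The radial retraction onto the disc of radius \<open>N\<close>. Unlike a cut-off by an indicator, it preserves
  continuity.
\<close>

definition clip :: "real \<Rightarrow> complex \<Rightarrow> complex" where
  "clip N z = z / of_real (max 1 (cmod z / N))"

lemma clip_id: "cmod z \<le> N \<Longrightarrow> N > 0 \<Longrightarrow> clip N z = z"
  by (simp add: clip_def max_def)

lemma norm_clip_le: "N > 0 \<Longrightarrow> cmod (clip N z) \<le> N"
  by (simp add: clip_def norm_divide max_def field_simps)

lemma norm_clip_le_norm: "cmod (clip N z) \<le> cmod z"
proof -
  have "cmod (clip N z) = cmod z / max 1 (cmod z / N)"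
    by (simp add: clip_def norm_divide)
  also have "\<dots> \<le> cmod z / 1" by (intro divide_left_mono) auto
  finally show ?thesis by simp
qed

lemma continuous_clip: "continuous_on UNIV (clip N)"
proof -
  have "continuous_on UNIV (\<lambda>z. z / complex_of_real (max 1 (cmod z * inverse N)))"
    by (intro continuous_intros) (auto simp: max_def)
  then show ?thesis by (simp add: clip_def[abs_def] divide_inverse)
qed

lemma clip_measurable: "f \<in> borel_measurable M \<Longrightarrow> (\<lambda>x. clip N (f x)) \<in> borel_measurable M"
  by (rule borel_measurable_continuous_on[OF continuous_clip])

lemma trig_limit_uniform:
  assumes "f \<in> borel_measurable unit_M"
    and "\<And>\<epsilon>. \<epsilon> > 0 \<Longrightarrow> \<exists>p. trig_poly p \<and> (\<forall>x\<in>{0..<1}. cmod (f x - p x) < \<epsilon>)"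
    and "f \<in> space_L2 unit_M"
  shows "trig_limit f"
  unfolding trig_limit_def
proof (intro conjI allI impI assms)
  fix \<epsilon> :: real assume "\<epsilon> > 0"
  then obtain p where p: "trig_poly p" "\<forall>x\<in>{0..<1}. cmod (f x - p x) < \<epsilon>/2"
    using assms(2)[of "\<epsilon>/2"] by auto
  have "norm_L2 unit_M (\<lambda>x. f x - p x) \<le> \<epsilon>/2"
  proof (rule norm_L2_unit_bounded)
    show "(\<lambda>x. f x - p x) \<in> borel_measurable unit_M"
      using assms(1) trig_poly_measurable[OF p(1), of "{0..<1}"] by (intro borel_measurable_diff) simp_all
  qed (use p(2) \<open>\<epsilon> > 0\<close> in \<open>simp_all add: less_imp_le\<close>)
  then show "\<exists>p. trig_poly p \<and> norm_L2 unit_M (\<lambda>x. f x - p x) < \<epsilon>"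
    using p \<open>\<epsilon> > 0\<close> by (intro exI[of _ p]) auto
qed

text \<open>
  A measurable function is almost everywhere a limit of continuous functions. Clipping these at the
  bound \<open>C\<close> makes the convergence dominated. The factor \<open>r n\<close> is the damping of
  \<open>trig_poly_approx_damped\<close>, which tends to \<open>1\<close> at every point other than \<open>0\<close>.
\<close>

lemma trig_limit_bounded:
  assumes f: "f \<in> borel_measurable unit_M" and C: "\<And>x. cmod (f x) \<le> C" and "C > 0"
  shows "trig_limit f"
proof -
  have "f measurable_on {0..<1}"
    using f by (simp add: measurable_on_iff_borel_measurable)
  then obtain N g where N: "negligible N" and g: "\<And>n. continuous_on UNIV (g n)"
    and lim: "\<And>x. x \<notin> N \<Longrightarrow> (\<lambda>n. g n x) \<longlonglongrightarrow> (if x \<in> {0..<1} then f x else 0)"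
    unfolding measurable_on_def by blast
  define r where "r n x = min 1 (real n * cmod (1 - cis (2 * pi * x)))" for n x
  define h where "h n x = clip C (g n x) * of_real (r n x)" for n x
  have cont: "continuous_on UNIV (\<lambda>x. clip C (g n x))" for n
    using continuous_on_compose2[OF continuous_clip g] by simp
  have conth: "continuous_on UNIV (h n)" for n
    unfolding h_def r_def by (intro continuous_intros cont)
  have r01: "0 \<le> r n x" "r n x \<le> 1" for n x by (auto simp: r_def)
  have hC: "cmod (h n x) \<le> C" for n x
  proof -
    have "cmod (h n x) \<le> C * 1" unfolding h_def norm_mult
      using r01[of n x] \<open>C > 0\<close> by (intro mult_mono norm_clip_le) auto
    then show ?thesis by simp
  qed
  have hm: "h n \<in> borel_measurable unit_M" for n
    by (rule continuous_measurable_lebesgue_on[OF continuous_on_subset[OF conth]]) auto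
  show ?thesis
  proof (rule trig_limit_dominated[where g = h and h = "\<lambda>_. (2 * C)\<^sup>2"])
    show "trig_limit (h n)" for n
      using trig_poly_approx_damped[OF cont[of n] norm_clip_le[OF \<open>C > 0\<close>], where k = "real n"]
      by (intro trig_limit_uniform space_L2_unit_bounded[of _ C] hm hC)
        (auto simp: h_def r_def)
    show "f \<in> space_L2 unit_M" using f C by (rule space_L2_unit_bounded)
    show "integrable unit_M (\<lambda>_. (2 * C)\<^sup>2)"
      using finite_measure.integrable_const[OF finite_measure_unit] .
    show "(cmod (f x - h n x))\<^sup>2 \<le> (2 * C)\<^sup>2" for n x
      using norm_triangle_ineq4[of "f x" "h n x"] C[of x] hC[of n x] by (intro power_mono) auto
    show "AE x in unit_M. (\<lambda>n. h n x) \<longlonglongrightarrow> f x"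
    proof -
      have "AE x in lebesgue. x \<notin> insert 0 N"
        using N by (intro AE_not_in) (simp add: negligible_iff_null_sets)
      then have "AE x in unit_M. x \<notin> insert 0 N"
        by (subst AE_restrict_space_iff) auto
      moreover have "AE x in unit_M. x \<in> {0..<1}"
        by (rule AE_I2) simp
      ultimately show ?thesis
      proof eventually_elim
        case (elim x)
        have "(\<lambda>n. clip C (g n x)) \<longlonglongrightarrow> clip C (f x)"
          using elim lim[of x] continuous_clip
          by (intro isCont_tendsto_compose[of _ "clip C"]) (auto simp: continuous_on_eq_continuous_at)
        moreover have "(\<lambda>n. r n x) \<longlonglongrightarrow> 1"
        proof -
          have "cis (2 * pi * x) \<noteq> 1"
          proof
            assume "cis (2 * pi * x) = 1"
            moreover have "Arg2pi (cis (2 * pi * x)) = 2 * pi * x"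
              using elim unfolding cis_conv_exp by (subst Arg2pi_exp) auto
            moreover have "Arg2pi 1 = 0" by (simp add: Arg2pi_eq_0)
            ultimately show False using elim by simp
          qed
          then have pos: "cmod (1 - cis (2 * pi * x)) > 0" by simp
          obtain k where k: "1 < real k * cmod (1 - cis (2 * pi * x))"
            using reals_Archimedean3[OF pos] by blast
          have "\<forall>\<^sub>F n in sequentially. r n x = 1"
            unfolding eventually_sequentially
          proof (intro exI[of _ k] allI impI)
            fix n assume "k \<le> n"
            then have "real k * cmod (1 - cis (2 * pi * x)) \<le> real n * cmod (1 - cis (2 * pi * x))"
              by (intro mult_right_mono) auto
            then show "r n x = 1" using k by (simp add: r_def)
          qed
          then show ?thesis by (rule tendsto_eventually)
        qed
        ultimately have "(\<lambda>n. h n x) \<longlonglongrightarrow> clip C (f x) * of_real 1"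
          unfolding h_def by (intro tendsto_intros)
        then show ?case using C[of x] \<open>C > 0\<close> by (simp add: clip_id)
      qed
    qed
  qed
qed

lemma trig_limit_space_L2:
  assumes f: "f \<in> space_L2 unit_M"
  shows "trig_limit f"
proof (rule trig_limit_dominated[where g = "\<lambda>n x. clip (real (Suc n)) (f x)" and h = "\<lambda>x. 4 * (cmod (f x))\<^sup>2"])
  show "trig_limit (\<lambda>x. clip (real (Suc n)) (f x))" for n
    by (rule trig_limit_bounded[where C = "real (Suc n)"])
      (auto intro: norm_clip_le clip_measurable[OF space_L2_measurable[OF f]])
  show "integrable unit_M (\<lambda>x. 4 * (cmod (f x))\<^sup>2)"
    using f by (simp add: space_L2_def)
  show "(cmod (f x - clip (real (Suc n)) (f x)))\<^sup>2 \<le> 4 * (cmod (f x))\<^sup>2" for n x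
  proof -
    have "cmod (f x - clip (real (Suc n)) (f x)) \<le> 2 * cmod (f x)"
      using norm_triangle_ineq4[of "f x" "clip (real (Suc n)) (f x)"] norm_clip_le_norm[of "real (Suc n)" "f x"]
      by linarith
    then show ?thesis using power_mono[of _ "2 * cmod (f x)" 2] by (auto simp: power_mult_distrib)
  qed
  show "AE x in unit_M. (\<lambda>n. clip (real (Suc n)) (f x)) \<longlonglongrightarrow> f x"
  proof (rule AE_I2, rule tendsto_eventually)
    fix x
    obtain k where k: "cmod (f x) \<le> real k" using real_arch_simple by blast
    show "\<forall>\<^sub>F n in sequentially. clip (real (Suc n)) (f x) = f x"
      unfolding eventually_sequentially using k
      by (intro exI[of _ k] allI impI clip_id) auto
  qed
qed (rule f)

text \<open>
  The phase \<open>2 \<pi> x - \<pi>\<close> runs through \<open>[-\<pi>, \<pi>)\<close>. It is centred because Kadec's expansion lives on an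
  interval that is symmetric about the origin; the integral is real for that reason.
\<close>

lemma integral_cis_unit:
  "(LINT x|unit_M. cis (\<omega> * (2 * pi * x - pi))) = of_real (if \<omega> = 0 then 1 else sin (pi * \<omega>) / (pi * \<omega>))"
proof (cases "\<omega> = 0")
  case True
  then show ?thesis using measure_unit_M by simp
next
  case False
  interpret finite_measure unit_M by (rule finite_measure_unit)
  have m: "(\<lambda>x. cis (\<omega> * (2 * pi * x - pi))) \<in> borel_measurable unit_M"
    by (intro continuous_measurable_lebesgue_on continuous_intros) auto
  have i: "integrable unit_M (\<lambda>x. cis (\<omega> * (2 * pi * x - pi)))"
    by (rule integrable_const_bound[of _ 1]) (auto simp: m)
  let ?P = "\<lambda>x. cis (\<omega> * (2 * pi * x - pi)) / (\<i> * of_real (2 * pi * \<omega>))"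
  have "((\<lambda>x. cis (\<omega> * (2 * pi * x - pi))) has_integral (?P 1 - ?P 0)) {0..1}"
  proof (rule fundamental_theorem_of_calculus)
    fix x :: real
    have "((\<lambda>z. exp (\<i> * (of_real \<omega> * (2 * of_real pi * z - of_real pi))) / (\<i> * of_real (2 * pi * \<omega>)))
        has_field_derivative exp (\<i> * (of_real \<omega> * (2 * of_real pi * of_real x - of_real pi)))) (at (of_real x))"
      using False by (auto intro!: derivative_eq_intros)
    then have "((\<lambda>x. exp (\<i> * (of_real \<omega> * (2 * of_real pi * of_real x - of_real pi))) / (\<i> * of_real (2 * pi * \<omega>)))
        has_vector_derivative exp (\<i> * (of_real \<omega> * (2 * of_real pi * of_real x - of_real pi)))) (at x within {0..1})"
      by (rule has_vector_derivative_real_field)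
    then show "(?P has_vector_derivative cis (\<omega> * (2 * pi * x - pi))) (at x within {0..1})"
      by (simp add: cis_conv_exp)
  qed simp
  then have "((\<lambda>x. cis (\<omega> * (2 * pi * x - pi))) has_integral (?P 1 - ?P 0)) {0..<1}"
    by (subst (asm) has_integral_spike_set_eq[of _ "{0..<1}"]) (auto intro: negligible_subset[of "{1}"])
  then have "(LINT x|unit_M. cis (\<omega> * (2 * pi * x - pi))) = ?P 1 - ?P 0"
    using lebesgue_integral_eq_integral[OF i] by (simp add: integral_unique)
  also have "\<dots> = (cis (pi * \<omega>) - cis (- (pi * \<omega>))) / (\<i> * of_real (2 * pi * \<omega>))"
    by (simp add: diff_divide_distrib algebra_simps)
  also have "cis (pi * \<omega>) - cis (- (pi * \<omega>)) = 2 * \<i> * of_real (sin (pi * \<omega>))"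
    by (simp add: complex_eq_iff)
  also have "\<dots> / (\<i> * of_real (2 * pi * \<omega>)) = of_real (sin (pi * \<omega>) / (pi * \<omega>))"
    by simp
  finally show ?thesis using False by simp
qed

section \<open>Parseval's identity on the unit interval\<close>

definition sincpi :: "real \<Rightarrow> real" where
  "sincpi \<omega> = (if \<omega> = 0 then 1 else sin (pi * \<omega>) / (pi * \<omega>))"

lemma sincpi_minus [simp]: "sincpi (- \<omega>) = sincpi \<omega>"
  by (simp add: sincpi_def)

lemma sincpi_of_int: "sincpi (of_int m) = (if m = 0 then 1 else 0)"
  using sin_npi_int[of m] by (simp add: sincpi_def mult.commute)

lemma inner_cis_harmonic:
  "inner_L2 unit_M (\<lambda>x. cis (\<omega> * (2 * pi * x - pi))) (harmonic n)
     = cis (- (pi * of_int n)) * of_real (sincpi (\<omega> - of_int n))"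
proof -
  have "cis (\<omega> * (2 * pi * x - pi)) * cnj (harmonic n x)
      = cis (- (pi * of_int n)) * cis ((\<omega> - of_int n) * (2 * pi * x - pi))" for x
    by (simp add: harmonic_def cis_cnj cis_mult algebra_simps)
  then show ?thesis
    unfolding inner_L2_def by (simp only: integral_mult_right_zero integral_cis_unit) (simp add: sincpi_def)
qed

lemma orthonormal_harmonic: "orthonormal_L2 unit_M harmonic"
  unfolding orthonormal_L2_def
proof (intro conjI allI harmonic_space)
  fix m n
  have "harmonic m = (\<lambda>x. cis (pi * of_int m) * cis (of_int m * (2 * pi * x - pi)))"
    by (auto simp: harmonic_def cis_mult algebra_simps)
  then have "inner_L2 unit_M (harmonic m) (harmonic n)
      = cis (pi * of_int m) * (cis (- (pi * of_int n)) * of_real (sincpi (of_int (m - n))))"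
    by (simp add: inner_L2_cmult_left inner_cis_harmonic)
  then show "inner_L2 unit_M (harmonic m) (harmonic n) = (if m = n then 1 else 0)"
    unfolding sincpi_of_int by (simp add: cis_mult)
qed

text \<open>
  The Fourier coefficients minimise the distance to the span, and that distance can be made
  arbitrarily small by \<open>trig_limit_space_L2\<close>.
\<close>

lemma parseval_harmonic: "parseval_L2 unit_M harmonic"
  unfolding parseval_L2_def
proof (intro ballI allI impI)
  fix w and \<epsilon> :: real assume w: "w \<in> space_L2 unit_M" and "\<epsilon> > 0"
  then obtain p where "trig_poly p" and p: "norm_L2 unit_M (\<lambda>x. w x - p x) < sqrt \<epsilon>"
    using trig_limit_space_L2[OF w] unfolding trig_limit_def by (meson real_sqrt_gt_zero)
  then obtain F c where F: "finite F" "p = (\<lambda>x. \<Sum>n\<in>F. c n * harmonic n x)"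
    using trig_poly_finite_sum by blast
  have "(norm_L2 unit_M (\<lambda>x. w x - p x))\<^sup>2 \<le> (sqrt \<epsilon>)\<^sup>2"
    using p by (intro power_mono) auto
  moreover have "0 \<le> (\<Sum>n\<in>F. (cmod (c n - inner_L2 unit_M w (harmonic n)))\<^sup>2)"
    by (intro sum_nonneg) auto
  ultimately have "(norm_L2 unit_M w)\<^sup>2 - \<epsilon> \<le> (\<Sum>n\<in>F. (cmod (inner_L2 unit_M w (harmonic n)))\<^sup>2)"
    using norm_diff_orthonormal_sum[OF orthonormal_harmonic F(1) w, of c] F(2) \<open>\<epsilon> > 0\<close>
    by (simp del: zero_le_power2)
  then show "\<exists>F. finite F \<and> (norm_L2 unit_M w)\<^sup>2 - \<epsilon>
      \<le> (\<Sum>n\<in>F. (cmod (inner_L2 unit_M w (harmonic n)))\<^sup>2)"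
    using F(1) by blast
qed

lemma norm_L2_harmonic [simp]: "norm_L2 unit_M (harmonic n) = 1"
proof -
  have "complex_of_real ((norm_L2 unit_M (harmonic n))\<^sup>2) = 1"
    using orthonormal_harmonic unfolding inner_L2_self[symmetric] orthonormal_L2_def by simp
  then have "(norm_L2 unit_M (harmonic n))\<^sup>2 = 1" using of_real_eq_1_iff by blast
  then show ?thesis using norm_L2_nonneg[of unit_M "harmonic n"] by (simp add: power2_eq_1_iff)
qed

lemma continuous_space_L2_unit:
  assumes "continuous_on {0..1} f"
  shows "f \<in> space_L2 unit_M"
proof -
  have "bounded (f ` {0..1})" using assms by (intro compact_imp_bounded compact_continuous_image) auto
  then obtain C where C: "\<forall>z\<in>f ` {0..1}. cmod z \<le> C" unfolding bounded_iff by blast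
  then have "\<And>x. x \<in> {0..1} \<Longrightarrow> cmod (f x) \<le> C" by simp
  then show ?thesis
    by (intro space_L2_unit_bounded[of _ C] continuous_measurable_lebesgue_on continuous_on_subset[OF assms])
      (simp_all add: subset_iff)
qed

lemma continuous_harmonic_coeffs_zero:
  assumes f: "continuous_on {0..1} f" and zero: "\<And>n. inner_L2 unit_M f (harmonic n) = 0"
    and x: "x \<in> {0..1}"
  shows "f x = 0"
proof -
  have fs: "f \<in> space_L2 unit_M" using f by (rule continuous_space_L2_unit)
  have "(norm_L2 unit_M f)\<^sup>2 \<le> 0"
  proof (rule field_le_epsilon)
    fix \<epsilon> :: real assume "\<epsilon> > 0"
    then obtain F where "(norm_L2 unit_M f)\<^sup>2 - \<epsilon> \<le> (\<Sum>n\<in>F. (cmod (inner_L2 unit_M f (harmonic n)))\<^sup>2)"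
      using parseval_harmonic fs unfolding parseval_L2_def by blast
    also have "\<dots> = 0" by (simp add: zero)
    finally show "(norm_L2 unit_M f)\<^sup>2 \<le> 0 + \<epsilon>" by linarith
  qed
  then have "norm_L2 unit_M f = 0" by simp
  then have "(LINT x|unit_M. (cmod (f x))\<^sup>2) = 0" using norm_L2_sq[of unit_M f] by simp
  then have "integral {0..<1} (\<lambda>x. (cmod (f x))\<^sup>2) = 0"
    using lebesgue_integral_eq_integral[OF space_L2_integrable[OF fs]] by simp
  moreover have "integral {0..<1} (\<lambda>x. (cmod (f x))\<^sup>2) = integral {0..1} (\<lambda>x. (cmod (f x))\<^sup>2)"
    by (rule integral_spike_set) (auto intro: negligible_subset[of "{1}"])
  ultimately have "integral (cbox 0 1) (\<lambda>x. (cmod (f x))\<^sup>2) = 0" by simp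
  then have "\<forall>x\<in>cbox 0 1. (cmod (f x))\<^sup>2 = 0"
    using f integral_cbox_eq_0_iff[of 0 "1::real" "\<lambda>x. (cmod (f x))\<^sup>2"]
    by (simp add: continuous_on_power continuous_on_norm)
  then show ?thesis using x by simp
qed

text \<open>
  A function series is identified by its Fourier coefficients: the uniformly convergent sum and \<open>g\<close> are
  continuous with equal coefficients, so they agree. This holds at both end points of the unit interval,
  without any periodicity, because the vanishing of a continuous function almost everywhere suffices.
\<close>

lemma harmonic_series_unique:
  fixes g :: "real \<Rightarrow> complex" and h :: "nat \<Rightarrow> real \<Rightarrow> complex"
  assumes g: "continuous_on UNIV g" and h: "\<And>k. continuous_on UNIV (h k)"
    and M: "summable M" "\<And>k x. cmod (h k x) \<le> M k"
    and coeffs: "\<And>n. (\<lambda>k. inner_L2 unit_M (h k) (harmonic n)) sums inner_L2 unit_M g (harmonic n)"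
    and x: "x \<in> {0..1}"
  shows "(\<lambda>k. h k x) sums g x"
proof -
  define H where "H x = (\<Sum>k. h k x)" for x
  have hs: "(\<lambda>k. h k x) sums H x" for x
    unfolding H_def using M by (intro summable_sums) (rule summable_comparison_test', auto)
  have lim: "uniform_limit UNIV (\<lambda>n x. \<Sum>k<n. h k x) H sequentially"
    unfolding H_def using M by (intro Weierstrass_m_test) auto
  have H: "continuous_on UNIV H"
    by (rule uniform_limit_theorem[OF _ lim]) (auto intro!: always_eventually continuous_intros h)
  have sp: "g \<in> space_L2 unit_M" "H \<in> space_L2 unit_M" "h k \<in> space_L2 unit_M" for k
    using g H h by (auto intro!: continuous_space_L2_unit intro: continuous_on_subset)
  have "(\<lambda>x. g x - H x) x = 0"
  proof (rule continuous_harmonic_coeffs_zero[OF _ _ x])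
    show "continuous_on {0..1} (\<lambda>x. g x - H x)"
      using g H by (intro continuous_intros) (auto intro: continuous_on_subset)
    fix n
    have "(\<lambda>m. \<Sum>k<m. inner_L2 unit_M (h k) (harmonic n)) \<longlonglongrightarrow> inner_L2 unit_M H (harmonic n)"
      unfolding LIMSEQ_iff
    proof (intro allI impI)
      fix \<epsilon> :: real assume "\<epsilon> > 0"
      then have "\<forall>\<^sub>F m in sequentially. \<forall>x\<in>UNIV. dist (\<Sum>k<m. h k x) (H x) < \<epsilon>/2"
        using lim unfolding uniform_limit_iff by (meson half_gt_zero)
      then obtain m0 where m0: "\<And>m x. m \<ge> m0 \<Longrightarrow> cmod ((\<Sum>k<m. h k x) - H x) < \<epsilon>/2"
        by (auto simp: eventually_sequentially dist_norm)
      have "cmod ((\<Sum>k<m. inner_L2 unit_M (h k) (harmonic n)) - inner_L2 unit_M H (harmonic n)) < \<epsilon>"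
        if "m \<ge> m0" for m
      proof -
        have d: "(\<lambda>x. (\<Sum>k<m. h k x) - H x) \<in> space_L2 unit_M"
          by (intro space_L2_diff space_L2_sum sp)
        have "(\<Sum>k<m. inner_L2 unit_M (h k) (harmonic n)) - inner_L2 unit_M H (harmonic n)
            = inner_L2 unit_M (\<lambda>x. (\<Sum>k<m. h k x) - H x) (harmonic n)"
          by (simp add: inner_L2_diff_left inner_L2_sum_left sp space_L2_sum harmonic_space)
        also have "cmod \<dots> \<le> norm_L2 unit_M (\<lambda>x. (\<Sum>k<m. h k x) - H x) * norm_L2 unit_M (harmonic n)"
          by (rule Cauchy_Schwarz_L2[OF d harmonic_space])
        also have "norm_L2 unit_M (\<lambda>x. (\<Sum>k<m. h k x) - H x) \<le> \<epsilon>/2"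
          using space_L2_measurable[OF d] m0[OF that] \<open>\<epsilon> > 0\<close>
          by (intro norm_L2_unit_bounded) (simp_all add: less_imp_le)
        finally show ?thesis using \<open>\<epsilon> > 0\<close> by simp
      qed
      then show "\<exists>m0. \<forall>m\<ge>m0. cmod ((\<Sum>k<m. inner_L2 unit_M (h k) (harmonic n)) - inner_L2 unit_M H (harmonic n)) < \<epsilon>"
        by blast
    qed
    then have "inner_L2 unit_M H (harmonic n) = inner_L2 unit_M g (harmonic n)"
      using coeffs[of n] unfolding sums_def by (rule LIMSEQ_unique)
    then show "inner_L2 unit_M (\<lambda>x. g x - H x) (harmonic n) = 0"
      by (simp add: inner_L2_diff_left sp harmonic_space)
  qed
  then show ?thesis using hs[of x] by simp
qed

section \<open>Half-integer sine and integer cosine expansions\<close>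

lemma inner_cos_harmonic:
  "inner_L2 unit_M (\<lambda>x. of_real (cos (\<omega> * (2 * pi * x - pi)))) (harmonic n)
     = cis (- (pi * of_int n)) * of_real ((sincpi (\<omega> - of_int n) + sincpi (\<omega> + of_int n)) / 2)"
proof -
  have sp: "(\<lambda>x. cis (\<omega> * (2 * pi * x - pi))) \<in> space_L2 unit_M" for \<omega>
    by (intro continuous_space_L2_unit continuous_intros)
  have "complex_of_real (cos (\<omega> * (2 * pi * x - pi)))
      = (1/2) * cis (\<omega> * (2 * pi * x - pi)) + (1/2) * cis ((-\<omega>) * (2 * pi * x - pi))" for x
    by (simp add: complex_eq_iff)
  then have "inner_L2 unit_M (\<lambda>x. of_real (cos (\<omega> * (2 * pi * x - pi)))) (harmonic n)
     = (1/2) * (cis (- (pi * of_int n)) * of_real (sincpi (\<omega> - of_int n)))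
       + (1/2) * (cis (- (pi * of_int n)) * of_real (sincpi (- \<omega> - of_int n)))"
    by (simp only: inner_L2_add_left inner_L2_cmult_left space_L2_cmult sp harmonic_space inner_cis_harmonic)
  also have "sincpi (- \<omega> - of_int n) = sincpi (\<omega> + of_int n)"
    using sincpi_minus[of "\<omega> + of_int n"] by (simp add: algebra_simps)
  finally show ?thesis by (simp add: field_simps)
qed

text \<open>
  The half-integer frequencies of \<open>sin ((k + 1/2) t)\<close> are not those of the harmonics; the unimodular
  factor \<open>exp (\<i> t / 2)\<close> moves them to integers.
\<close>

lemma inner_half_shifted_sin_harmonic:
  "inner_L2 unit_M (\<lambda>x. cis ((2 * pi * x - pi) / 2) * of_real (sin (\<omega> * (2 * pi * x - pi)))) (harmonic n)
     = - \<i> / 2 * cis (- (pi * of_int n)) * of_real (sincpi (\<omega> + 1/2 - of_int n) - sincpi (\<omega> - 1/2 + of_int n))"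
proof -
  have sp: "(\<lambda>x. cis (\<omega> * (2 * pi * x - pi))) \<in> space_L2 unit_M" for \<omega>
    by (intro continuous_space_L2_unit continuous_intros)
  have "cis ((2 * pi * x - pi) / 2) * of_real (sin (\<omega> * (2 * pi * x - pi)))
      = (- \<i> / 2) * cis ((\<omega> + 1/2) * (2 * pi * x - pi)) - (- \<i> / 2) * cis ((1/2 - \<omega>) * (2 * pi * x - pi))" for x
  proof -
    have "complex_of_real (sin y) = (- \<i> / 2) * (cis y - cis (- y))" for y
      by (simp add: complex_eq_iff)
    moreover have "cis ((\<omega> + 1/2) * t) = cis (t/2) * cis (\<omega> * t)" "cis ((1/2 - \<omega>) * t) = cis (t/2) * cis (- (\<omega> * t))" for t
      unfolding cis_mult by (rule arg_cong[of _ _ cis], simp add: algebra_simps)+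
    ultimately show ?thesis by (simp only:) (simp only: algebra_simps)
  qed
  then have "inner_L2 unit_M (\<lambda>x. cis ((2 * pi * x - pi) / 2) * of_real (sin (\<omega> * (2 * pi * x - pi)))) (harmonic n)
     = (- \<i> / 2) * (cis (- (pi * of_int n)) * of_real (sincpi (\<omega> + 1/2 - of_int n)))
       - (- \<i> / 2) * (cis (- (pi * of_int n)) * of_real (sincpi (1/2 - \<omega> - of_int n)))"
    by (simp only: inner_L2_diff_left inner_L2_cmult_left space_L2_cmult sp harmonic_space inner_cis_harmonic)
  also have "sincpi (1/2 - \<omega> - of_int n) = sincpi (\<omega> - 1/2 + of_int n)"
    using sincpi_minus[of "\<omega> - 1/2 + of_int n"] by (simp add: algebra_simps)
  finally show ?thesis by (simp add: algebra_simps)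
qed

text \<open>
  The coefficients of \<open>1 - cos (\<delta> t)\<close> in the functions \<open>cos (k t)\<close>, \<open>\<bar>t\<bar> \<le> \<pi>\<close>.
\<close>

definition cosine_coeff :: "real \<Rightarrow> nat \<Rightarrow> real" where
  "cosine_coeff \<delta> k = (if k = 0 then 1 - sincpi \<delta>
     else (-1) ^ k * (2 * \<delta> * sin (pi * \<delta>)) / (pi * ((real k)\<^sup>2 - \<delta>\<^sup>2)))"

text \<open>
  The coefficients of \<open>sin (\<delta> t)\<close> in the functions \<open>sin ((k + 1/2) t)\<close>, \<open>\<bar>t\<bar> \<le> \<pi>\<close>.
\<close>

definition sine_coeff :: "real \<Rightarrow> nat \<Rightarrow> real" where
  "sine_coeff \<delta> k = (-1) ^ k * (2 * \<delta> * cos (pi * \<delta>)) / (pi * ((real k + 1/2)\<^sup>2 - \<delta>\<^sup>2))"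

text \<open>
  Here \<open>s\<close> stands for \<open>k \<ge> 1\<close> in the cosine coefficients and for \<open>k + 1/2\<close> in the sine
  coefficients; both are at least \<open>(k + 1) / 2\<close>. The constant is \<open>1/4 - 1/16\<close>.
\<close>

lemma sq_diff_lower:
  assumes "\<bar>\<delta>\<bar> \<le> 1/4" "s \<ge> 1/2" "s \<ge> (real k + 1) / 2"
  shows "s\<^sup>2 - \<delta>\<^sup>2 \<ge> 3/16 * (real (Suc k))\<^sup>2"
proof -
  have "\<delta>\<^sup>2 \<le> (1/4)\<^sup>2" using assms(1) by (metis abs_ge_zero power2_abs power_mono)
  then have 1: "\<delta>\<^sup>2 \<le> 1/16" by (simp add: power2_eq_square)
  have "((real k + 1) / 2)\<^sup>2 \<le> s\<^sup>2" using assms by (intro power_mono) auto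
  then have 2: "(real (Suc k))\<^sup>2 / 4 \<le> s\<^sup>2" by (simp add: power_divide add.commute)
  have "(1::real)\<^sup>2 \<le> (real (Suc k))\<^sup>2" by (intro power_mono) auto
  then show ?thesis using 1 2 unfolding one_power2 by linarith
qed

lemma coeff_frac_bound:
  assumes "\<bar>\<delta>\<bar> \<le> 1/4" "\<bar>u\<bar> \<le> 1" "s \<ge> 1/2" "s \<ge> (real k + 1) / 2"
  shows "\<bar>(-1) ^ k * (2 * \<delta> * u) / (pi * (s\<^sup>2 - \<delta>\<^sup>2))\<bar> \<le> 2 / (real (Suc k))\<^sup>2"
proof -
  have l: "3/16 * (real (Suc k))\<^sup>2 \<le> s\<^sup>2 - \<delta>\<^sup>2" using assms by (intro sq_diff_lower)
  have pos: "0 < 3/16 * (real (Suc k))\<^sup>2" by simp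
  have p3: "3 \<le> pi" using pi_gt3 by simp
  have "3 * (3/16 * (real (Suc k))\<^sup>2) \<le> pi * (s\<^sup>2 - \<delta>\<^sup>2)"
    using l pos p3 by (intro mult_mono) auto
  moreover have "2 * \<bar>\<delta>\<bar> * \<bar>u\<bar> \<le> 1/2 * 1" using assms by (intro mult_mono) auto
  ultimately have "(2 * \<bar>\<delta>\<bar> * \<bar>u\<bar>) / (pi * (s\<^sup>2 - \<delta>\<^sup>2)) \<le> (1/2 * 1) / (3 * (3/16 * (real (Suc k))\<^sup>2))"
    using pos by (intro frac_le) auto
  also have "\<dots> = (8/9) / (real (Suc k))\<^sup>2" by simp
  also have "\<dots> \<le> 2 / (real (Suc k))\<^sup>2" by (intro divide_right_mono) auto
  finally have "(2 * \<bar>\<delta>\<bar> * \<bar>u\<bar>) / (pi * (s\<^sup>2 - \<delta>\<^sup>2)) \<le> 2 / (real (Suc k))\<^sup>2" .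
  moreover have "\<bar>s\<^sup>2 - \<delta>\<^sup>2\<bar> = s\<^sup>2 - \<delta>\<^sup>2" using l pos by (intro abs_of_pos) linarith
  ultimately show ?thesis by (simp add: abs_mult abs_divide power_abs)
qed

lemma cosine_coeff_bound:
  assumes "\<bar>\<delta>\<bar> \<le> 1/4"
  shows "\<bar>cosine_coeff \<delta> k\<bar> \<le> 2 / (real (Suc k))\<^sup>2"
proof (cases "k = 0")
  case True
  have "\<bar>sincpi \<delta>\<bar> \<le> 1"
    using abs_sin_x_le_abs_x[of "pi * \<delta>"] by (simp add: sincpi_def abs_divide divide_le_eq_1)
  then show ?thesis using True by (simp add: cosine_coeff_def)
next
  case False
  then show ?thesis using coeff_frac_bound[of \<delta> "sin (pi * \<delta>)" "real k" k] assms
    by (simp add: cosine_coeff_def)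
qed

lemma sine_coeff_bound:
  assumes "\<bar>\<delta>\<bar> \<le> 1/4"
  shows "\<bar>sine_coeff \<delta> k\<bar> \<le> 2 / (real (Suc k))\<^sup>2"
  using coeff_frac_bound[of \<delta> "cos (pi * \<delta>)" "real k + 1/2" k] assms
  by (simp add: sine_coeff_def)

lemma summable_coeff_bound: "summable (\<lambda>k. 2 / (real (Suc k))\<^sup>2)"
proof -
  have "summable (\<lambda>k. inverse (real k ^ 2))" by (rule inverse_power_summable) simp
  then have "summable (\<lambda>k. 2 * inverse (real (Suc k) ^ 2))"
    by (intro summable_mult) (subst summable_Suc_iff)
  then show ?thesis by (simp add: divide_inverse)
qed

lemma sincpi_minus_int:
  assumes "\<delta> \<noteq> of_int n"
  shows "sincpi (\<delta> - of_int n) = cos (pi * of_int n) * sin (pi * \<delta>) / (pi * (\<delta> - of_int n))"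
proof -
  have "sin (pi * (\<delta> - of_int n)) = sin (pi * \<delta>) * cos (pi * of_int n)"
    by (simp add: right_diff_distrib sin_diff)
  then show ?thesis using assms by (simp add: sincpi_def mult.commute)
qed

text \<open>
  The \<open>n\<close>th Fourier coefficient of the series has the single contribution \<open>k = \<bar>n\<bar>\<close>, shared equally
  by \<open>n\<close> and \<open>- n\<close> unless \<open>n = 0\<close>.
\<close>

lemma cos_expansion:
  assumes \<delta>: "\<bar>\<delta>\<bar> \<le> 1/4" and t: "\<bar>t\<bar> \<le> pi"
  shows "(\<lambda>k. cosine_coeff \<delta> k * cos (real k * t)) sums (1 - cos (\<delta> * t))"
proof -
  let ?h = "\<lambda>k x. complex_of_real (cosine_coeff \<delta> k) * of_real (cos (real k * (2 * pi * x - pi)))"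
  let ?g = "\<lambda>x. complex_of_real (cos (0 * (2 * pi * x - pi))) - of_real (cos (\<delta> * (2 * pi * x - pi)))"
  define x where "x = (t + pi) / (2 * pi)"
  have x: "x \<in> {0..1}" "2 * pi * x - pi = t"
    using t pi_gt_zero by (auto simp: x_def field_simps)
  have sp: "(\<lambda>x. complex_of_real (cos (\<omega> * (2 * pi * x - pi)))) \<in> space_L2 unit_M" for \<omega>
    by (intro continuous_space_L2_unit continuous_intros)
  have "(\<lambda>k. ?h k x) sums ?g x"
  proof (rule harmonic_series_unique[OF _ _ summable_coeff_bound _ _ x(1)])
    show "continuous_on UNIV ?g" "continuous_on UNIV (?h k)" for k
      by (intro continuous_intros)+
    show "cmod (?h k x) \<le> 2 / (real (Suc k))\<^sup>2" for k x
    proof -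
      have "\<bar>cosine_coeff \<delta> k\<bar> * \<bar>cos (real k * (2 * pi * x - pi))\<bar> \<le> 2 / (real (Suc k))\<^sup>2 * 1"
        using cosine_coeff_bound[OF \<delta>] by (intro mult_mono) auto
      then show ?thesis by (simp add: norm_mult)
    qed
    fix n :: int
    let ?a = "cosine_coeff \<delta> (nat \<bar>n\<bar>) * (if n = 0 then 1 else 1/2)"
    have hk: "inner_L2 unit_M (?h k) (harmonic n)
        = (if k = nat \<bar>n\<bar> then cis (- (pi * of_int n)) * of_real ?a else 0)" for k
    proof -
      have "sincpi (real k - of_int n) = (if int k = n then 1 else 0)"
        using sincpi_of_int[of "int k - n"] by simp
      moreover have "sincpi (real k + of_int n) = (if int k = - n then 1 else 0)"
        using sincpi_of_int[of "int k + n"] by auto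
      ultimately show ?thesis
        unfolding inner_L2_cmult_left inner_cos_harmonic by auto
    qed
    have "inner_L2 unit_M ?g (harmonic n) = cis (- (pi * of_int n)) *
      of_real ((if n = 0 then 1 else 0) - (sincpi (\<delta> - of_int n) + sincpi (\<delta> + of_int n)) / 2)"
      unfolding inner_L2_diff_left[OF sp sp harmonic_space] inner_cos_harmonic
      using sincpi_of_int[of n] by (auto simp: algebra_simps)
    also have "(if n = 0 then 1 else 0) - (sincpi (\<delta> - of_int n) + sincpi (\<delta> + of_int n)) / 2 = ?a"
    proof (cases "n = 0")
      case True
      then show ?thesis by (simp add: cosine_coeff_def)
    next
      case False
      then have n1: "1 \<le> \<bar>real_of_int n\<bar>" by simp
      then have ne: "\<delta> \<noteq> of_int n" "\<delta> \<noteq> of_int (- n)" using \<delta> by auto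
      then have ne': "\<delta> - of_int n \<noteq> 0" "\<delta> + of_int n \<noteq> 0" by auto
      have sgn: "(-1) ^ nat \<bar>n\<bar> = cos (pi * of_int n)"
        by (simp add: cos_npi_int minus_one_power_iff even_nat_iff)
      have sq: "(real (nat \<bar>n\<bar>))\<^sup>2 = (of_int n)\<^sup>2" by simp
      have plus: "sincpi (\<delta> + of_int n) = cos (pi * of_int n) * sin (pi * \<delta>) / (pi * (\<delta> + of_int n))"
        using sincpi_minus_int[OF ne(2)] by simp
      have combine: "(c / (pi * u) + c / (pi * v)) / 2 = c / pi * ((1 / u + 1 / v) / 2)" for c u v :: real
        by (simp add: distrib_left add_divide_distrib)
      have "(sincpi (\<delta> - of_int n) + sincpi (\<delta> + of_int n)) / 2
          = cos (pi * of_int n) * sin (pi * \<delta>) / pi * ((1 / (\<delta> - of_int n) + 1 / (\<delta> + of_int n)) / 2)"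
        unfolding sincpi_minus_int[OF ne(1)] plus by (rule combine)
      also have "(1 / (\<delta> - of_int n) + 1 / (\<delta> + of_int n)) / 2 = \<delta> / (\<delta>\<^sup>2 - (of_int n)\<^sup>2)"
      proof -
        have "\<delta>\<^sup>2 - (of_int n)\<^sup>2 = (\<delta> - of_int n) * (\<delta> + of_int n)"
          by (simp add: power2_eq_square algebra_simps)
        moreover have "1 / a + 1 / b = (a + b) / (a * b)" if "a \<noteq> 0" "b \<noteq> 0" for a b :: real
          using that by (simp add: field_simps)
        ultimately show ?thesis using ne' by simp
      qed
      also have "\<dots> = - (\<delta> / ((of_int n)\<^sup>2 - \<delta>\<^sup>2))"
        by (metis minus_diff_eq minus_divide_right)
      finally show ?thesis
        using False unfolding cosine_coeff_def sgn sq by simp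
    qed
    finally have gn: "inner_L2 unit_M ?g (harmonic n) = cis (- (pi * of_int n)) * of_real ?a" .
    show "(\<lambda>k. inner_L2 unit_M (?h k) (harmonic n)) sums inner_L2 unit_M ?g (harmonic n)"
      unfolding hk gn by (rule sums_single)
  qed
  then have "(\<lambda>k. complex_of_real (cosine_coeff \<delta> k * cos (real k * t))) sums of_real (1 - cos (\<delta> * t))"
    unfolding x(2) by simp
  then show ?thesis by (simp only: sums_of_real_iff)
qed

text \<open>
  After multiplication by \<open>exp (\<i> t / 2)\<close> the \<open>k\<close>th term has the frequencies \<open>k + 1\<close> and \<open>- k\<close>. So the
  \<open>n\<close>th Fourier coefficient of the series comes from the single index \<open>\<kappa>\<close>, which is \<open>n - 1\<close> or \<open>- n\<close>,
  with the sign \<open>s\<close>.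
\<close>

lemma sin_expansion:
  assumes \<delta>: "\<bar>\<delta>\<bar> \<le> 1/4" and t: "\<bar>t\<bar> \<le> pi"
  shows "(\<lambda>k. sine_coeff \<delta> k * sin ((real k + 1/2) * t)) sums sin (\<delta> * t)"
proof -
  let ?s = "\<lambda>\<omega> x. cis ((2 * pi * x - pi) / 2) * complex_of_real (sin (\<omega> * (2 * pi * x - pi)))"
  let ?h = "\<lambda>k x. complex_of_real (sine_coeff \<delta> k) * ?s (real k + 1/2) x"
  define x where "x = (t + pi) / (2 * pi)"
  have x: "x \<in> {0..1}" "2 * pi * x - pi = t"
    using t pi_gt_zero by (auto simp: x_def field_simps)
  have "(\<lambda>k. ?h k x) sums ?s \<delta> x"
  proof (rule harmonic_series_unique[OF _ _ summable_coeff_bound _ _ x(1)])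
    show "continuous_on UNIV (?s \<delta>)"
      by (intro continuous_intros) simp
    show "continuous_on UNIV (?h k)" for k
      by (intro continuous_intros) simp
    show "cmod (?h k x) \<le> 2 / (real (Suc k))\<^sup>2" for k x
    proof -
      have "\<bar>sine_coeff \<delta> k\<bar> * \<bar>sin ((real k + 1/2) * (2 * pi * x - pi))\<bar> \<le> 2 / (real (Suc k))\<^sup>2 * 1"
        using sine_coeff_bound[OF \<delta>] by (intro mult_mono) auto
      then show ?thesis by (simp add: norm_mult)
    qed
    fix n :: int
    define \<kappa> where "\<kappa> = nat (if n \<ge> 1 then n - 1 else - n)"
    define s where "s = (if n \<ge> 1 then 1 else -1 :: real)"
    let ?c = "- \<i> / 2 * cis (- (pi * of_int n))"
    have hk: "inner_L2 unit_M (?h k) (harmonic n)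
        = (if k = \<kappa> then ?c * of_real (sine_coeff \<delta> \<kappa> * s) else 0)" for k
    proof -
      have "sincpi (real k + 1/2 + 1/2 - of_int n) = (if int k + 1 = n then 1 else 0)"
      proof -
        have "real k + 1/2 + 1/2 - of_int n = of_int (int k + 1 - n)" by simp
        then show ?thesis by (simp only: sincpi_of_int) simp
      qed
      moreover have "sincpi (real k + 1/2 - 1/2 + of_int n) = (if int k = - n then 1 else 0)"
        using sincpi_of_int[of "int k + n"] by auto
      ultimately show ?thesis
        unfolding inner_L2_cmult_left inner_half_shifted_sin_harmonic by (auto simp: \<kappa>_def s_def)
    qed
    have half: "\<bar>real_of_int n - 1/2\<bar> \<ge> 1/2"
    proof (cases "n \<ge> 1")
      case True
      then have "real_of_int n \<ge> 1" by simp
      then show ?thesis by simp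
    next
      case False
      then have "real_of_int n \<le> 0" by simp
      then show ?thesis by simp
    qed
    have ne: "\<delta> + 1/2 - of_int n \<noteq> 0" "\<delta> - 1/2 + of_int n \<noteq> 0" using half \<delta> by linarith+
    have *: "sin (pi * (\<delta> + 1/2 - of_int n)) = cos (pi * of_int n) * cos (pi * \<delta>)"
      "sin (pi * (\<delta> - 1/2 + of_int n)) = - (cos (pi * of_int n) * cos (pi * \<delta>))"
      by (simp_all add: right_diff_distrib distrib_left sin_diff sin_add)
    have "sincpi (\<delta> + 1/2 - of_int n) - sincpi (\<delta> - 1/2 + of_int n)
        = cos (pi * of_int n) * cos (pi * \<delta>) / pi * (1 / (\<delta> + 1/2 - of_int n) + 1 / (\<delta> - 1/2 + of_int n))"
    proof -
      have "c / (pi * u) - (- c) / (pi * v) = c / pi * (1 / u + 1 / v)" for c u v :: real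
        by (simp add: distrib_left)
      then show ?thesis using ne * by (simp only: sincpi_def if_False)
    qed
    also have "1 / (\<delta> + 1/2 - of_int n) + 1 / (\<delta> - 1/2 + of_int n)
        = 2 * \<delta> / (\<delta>\<^sup>2 - (of_int n - 1/2)\<^sup>2)"
    proof -
      have "\<delta>\<^sup>2 - (of_int n - 1/2)\<^sup>2 = (\<delta> + 1/2 - of_int n) * (\<delta> - 1/2 + of_int n)"
        by (simp add: power2_eq_square field_simps)
      moreover have "1 / a + 1 / b = (a + b) / (a * b)" if "a \<noteq> 0" "b \<noteq> 0" for a b :: real
        using that by (simp add: field_simps)
      ultimately show ?thesis using ne by simp
    qed
    also have "\<dots> = - (2 * \<delta> / ((of_int n - 1/2)\<^sup>2 - \<delta>\<^sup>2))"
      by (metis minus_diff_eq minus_divide_right)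
    also have "cos (pi * of_int n) * cos (pi * \<delta>) / pi * \<dots> = sine_coeff \<delta> \<kappa> * s"
    proof -
      have "real \<kappa> + 1/2 = \<bar>of_int n - 1/2\<bar>" by (auto simp: \<kappa>_def)
      then have sq: "(real \<kappa> + 1/2)\<^sup>2 = (of_int n - 1/2)\<^sup>2" by simp
      have sgn: "(-1) ^ \<kappa> * s = - cos (pi * of_int n)"
        by (auto simp: \<kappa>_def s_def cos_npi_int minus_one_power_iff even_nat_iff)
      have "sine_coeff \<delta> \<kappa> * s = ((-1) ^ \<kappa> * s) * (2 * \<delta> * cos (pi * \<delta>)) / (pi * ((of_int n - 1/2)\<^sup>2 - \<delta>\<^sup>2))"
        unfolding sine_coeff_def sq by simp
      then show ?thesis unfolding sgn by simp
    qed
    finally have gn: "inner_L2 unit_M (?s \<delta>) (harmonic n) = ?c * of_real (sine_coeff \<delta> \<kappa> * s)"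
      unfolding inner_half_shifted_sin_harmonic by simp
    show "(\<lambda>k. inner_L2 unit_M (?h k) (harmonic n)) sums inner_L2 unit_M (?s \<delta>) (harmonic n)"
      unfolding hk gn by (rule sums_single)
  qed
  then have "(\<lambda>k. cis (t/2) * of_real (sine_coeff \<delta> k * sin ((real k + 1/2) * t))) sums
     (cis (t/2) * of_real (sin (\<delta> * t)))"
    unfolding x(2) by (simp add: mult_ac)
  then have "(\<lambda>k. cnj (cis (t/2)) * (cis (t/2) * of_real (sine_coeff \<delta> k * sin ((real k + 1/2) * t)))) sums
     (cnj (cis (t/2)) * (cis (t/2) * of_real (sin (\<delta> * t))))"
    by (rule sums_mult)
  then have "(\<lambda>k. complex_of_real (sine_coeff \<delta> k * sin ((real k + 1/2) * t))) sums of_real (sin (\<delta> * t))"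
    unfolding mult.assoc[symmetric] by (simp add: cis_cnj cis_mult)
  then show ?thesis by (simp only: sums_of_real_iff)
qed

section \<open>Kadec's estimate for bounded phases\<close>

lemma x_cos_le_sin:
  assumes "0 \<le> x" "x \<le> pi"
  shows "x * cos x \<le> sin (x::real)"
proof -
  have "sin 0 - 0 * cos 0 \<le> sin x - x * cos x"
  proof (rule DERIV_nonneg_imp_nondecreasing[OF assms(1)])
    fix y :: real assume y: "0 \<le> y" "y \<le> x"
    have "((\<lambda>x. sin x - x * cos x) has_real_derivative y * sin y) (at y)"
      by (auto intro!: derivative_eq_intros)
    moreover have "0 \<le> y * sin y" using y assms by (intro mult_nonneg_nonneg sin_ge_zero) auto
    ultimately show "\<exists>d. ((\<lambda>x. sin x - x * cos x) has_real_derivative d) (at y) \<and> 0 \<le> d" by blast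
  qed
  then show ?thesis by simp
qed

lemma sincpi_antimono:
  assumes "0 \<le> x" "x \<le> y" "y \<le> 1"
  shows "sincpi y \<le> sincpi x"
proof (cases "x = 0")
  case True
  then show ?thesis using abs_sin_x_le_abs_x[of "pi * y"] assms
    by (auto simp: sincpi_def divide_le_eq_1)
next
  case False
  have "sin (pi * y) / (pi * y) \<le> sin (pi * x) / (pi * x)"
  proof (rule DERIV_nonpos_imp_nonincreasing[where f = "\<lambda>z. sin (pi * z) / (pi * z)", OF assms(2)])
    fix z assume z: "x \<le> z" "z \<le> y"
    let ?d = "(pi * (pi * z * cos (pi * z) - sin (pi * z))) / (pi * z)\<^sup>2"
    have "z > 0" using z False assms by auto
    then have "((\<lambda>z. sin (pi * z) / (pi * z)) has_real_derivative ?d) (at z)"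
      by (auto intro!: derivative_eq_intros simp: power2_eq_square algebra_simps)
    moreover have "?d \<le> 0"
      using x_cos_le_sin[of "pi * z"] \<open>z > 0\<close> z assms
      by (intro divide_nonpos_nonneg mult_nonneg_nonpos) auto
    ultimately show "\<exists>d. ((\<lambda>z. sin (pi * z) / (pi * z)) has_real_derivative d) (at z) \<and> d \<le> 0" by blast
  qed
  then show ?thesis using False assms by (simp add: sincpi_def)
qed

lemma x_cos_pi_mono:
  assumes "0 \<le> x" "x \<le> y" "y \<le> (1/4::real)"
  shows "x * cos (pi * x) \<le> y * cos (pi * y)"
proof (rule DERIV_nonneg_imp_nondecreasing[where f = "\<lambda>z. z * cos (pi * z)", OF assms(2)])
  fix z assume z: "x \<le> z" "z \<le> y"
  have "((\<lambda>z. z * cos (pi * z)) has_real_derivative cos (pi * z) - pi * z * sin (pi * z)) (at z)"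
    by (auto intro!: derivative_eq_intros)
  moreover have "pi * z * sin (pi * z) \<le> cos (pi * z)"
  proof -
    have pz: "0 \<le> pi * z" "pi * z \<le> pi / 4" using z assms pi_gt_zero by (auto simp: field_simps)
    have s: "0 \<le> sin (pi * z)" using pz by (intro sin_ge_zero) auto
    have "pi * z \<le> 1" using pz(2) pi_less_4 by linarith
    then have "pi * z * sin (pi * z) \<le> 1 * sin (pi * z)"
      using s by (rule mult_right_mono)
    also have "sin (pi * z) \<le> sin (pi / 4)" using pz pi_gt_zero by (intro sin_monotone_2pi_le; linarith)
    also have "sin (pi / 4) = cos (pi / 4)" by (simp add: sin_45 cos_45)
    also have "\<dots> \<le> cos (pi * z)" using pz pi_gt_zero by (intro cos_monotone_0_pi_le; linarith)
    finally show ?thesis by simp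
  qed
  ultimately show "\<exists>d. ((\<lambda>z. z * cos (pi * z)) has_real_derivative d) (at z) \<and> 0 \<le> d" by force
qed

text \<open>
  Numerator and denominator are both monotone in \<open>\<bar>\<delta>\<bar>\<close>; the parameter \<open>v\<close> is the value at \<open>L\<close> of the
  trigonometric factor whose value at \<open>\<delta>\<close> is \<open>u\<close>.
\<close>

lemma coeff_frac_mono:
  assumes "\<bar>\<delta>\<bar> \<le> L" "L \<le> 1/4" "s \<ge> 1/2" "\<bar>\<delta>\<bar> * \<bar>u\<bar> \<le> L * v"
  shows "\<bar>(-1) ^ k * (2 * \<delta> * u) / (pi * (s\<^sup>2 - \<delta>\<^sup>2))\<bar> \<le> (2 * L * v) / (pi * (s\<^sup>2 - L\<^sup>2))"
proof -
  have "\<delta>\<^sup>2 \<le> L\<^sup>2" using assms(1) by (metis abs_ge_zero power2_abs power_mono)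
  moreover have "L\<^sup>2 < s\<^sup>2" using assms by (intro power_strict_mono) auto
  ultimately have d: "0 < s\<^sup>2 - L\<^sup>2" "s\<^sup>2 - L\<^sup>2 \<le> s\<^sup>2 - \<delta>\<^sup>2" by auto
  have "\<bar>(-1) ^ k * (2 * \<delta> * u) / (pi * (s\<^sup>2 - \<delta>\<^sup>2))\<bar> = (2 * (\<bar>\<delta>\<bar> * \<bar>u\<bar>)) / (pi * (s\<^sup>2 - \<delta>\<^sup>2))"
  proof -
    have "\<bar>s\<^sup>2 - \<delta>\<^sup>2\<bar> = s\<^sup>2 - \<delta>\<^sup>2" using d by linarith
    then show ?thesis by (simp add: abs_mult abs_divide power_abs)
  qed
  also have "\<dots> \<le> (2 * (L * v)) / (pi * (s\<^sup>2 - L\<^sup>2))"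
  proof (rule frac_le)
    have "0 \<le> \<bar>\<delta>\<bar> * \<bar>u\<bar>" by simp
    then show "0 \<le> 2 * (L * v)" using assms(4) by linarith
    show "2 * (\<bar>\<delta>\<bar> * \<bar>u\<bar>) \<le> 2 * (L * v)" using assms(4) by linarith
    show "0 < pi * (s\<^sup>2 - L\<^sup>2)" using d by simp
    show "pi * (s\<^sup>2 - L\<^sup>2) \<le> pi * (s\<^sup>2 - \<delta>\<^sup>2)" using d by (intro mult_left_mono) auto
  qed
  finally show ?thesis by simp
qed

lemma cosine_coeff_mono:
  assumes "\<bar>\<delta>\<bar> \<le> L" "L \<le> 1/4"
  shows "\<bar>cosine_coeff \<delta> k\<bar> \<le> (-1) ^ k * cosine_coeff L k"
proof (cases "k = 0")
  case True
  have "sincpi \<delta> = sincpi \<bar>\<delta>\<bar>" by (simp add: abs_if)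
  moreover have "sincpi L \<le> sincpi \<bar>\<delta>\<bar>" "sincpi \<bar>\<delta>\<bar> \<le> sincpi 0"
    using assms by (auto intro!: sincpi_antimono)
  moreover have "sincpi 0 = 1" by (simp add: sincpi_def)
  ultimately show ?thesis using True by (simp add: cosine_coeff_def)
next
  case False
  have "\<bar>\<delta>\<bar> * \<bar>sin (pi * \<delta>)\<bar> \<le> L * sin (pi * L)"
  proof (rule mult_mono)
    have p: "0 \<le> pi * \<bar>\<delta>\<bar>" "pi * \<bar>\<delta>\<bar> \<le> pi * L" "pi * L \<le> pi * (1/4)"
      using assms by (intro mult_nonneg_nonneg mult_left_mono; simp)+
    have "0 \<le> sin (pi * \<bar>\<delta>\<bar>)" "sin (pi * \<bar>\<delta>\<bar>) \<le> sin (pi * L)"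
      using p pi_gt_zero by (intro sin_ge_zero; linarith) (intro sin_monotone_2pi_le; use p pi_gt_zero in linarith)
    moreover have "\<bar>sin (pi * \<delta>)\<bar> = \<bar>sin (pi * \<bar>\<delta>\<bar>)\<bar>" by (simp add: abs_if)
    ultimately show "\<bar>sin (pi * \<delta>)\<bar> \<le> sin (pi * L)" by simp
  qed (use assms in auto)
  then have "\<bar>cosine_coeff \<delta> k\<bar> \<le> (2 * L * sin (pi * L)) / (pi * ((real k)\<^sup>2 - L\<^sup>2))"
    using coeff_frac_mono[OF assms, of "real k" "sin (pi * \<delta>)" "sin (pi * L)" k] False
    by (simp add: cosine_coeff_def)
  also have "\<dots> = (-1) ^ k * cosine_coeff L k"
    using False by (simp add: cosine_coeff_def)
  finally show ?thesis .
qed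

lemma sine_coeff_mono:
  assumes "\<bar>\<delta>\<bar> \<le> L" "L \<le> 1/4"
  shows "\<bar>sine_coeff \<delta> k\<bar> \<le> (-1) ^ k * sine_coeff L k"
proof -
  have "0 \<le> cos (pi * \<bar>\<delta>\<bar>)"
  proof (rule cos_ge_zero)
    have "pi * \<bar>\<delta>\<bar> \<le> pi * (1/4)" using assms by (intro mult_left_mono) auto
    then show "pi * \<bar>\<delta>\<bar> \<le> pi / 2" by simp
    have "0 \<le> pi * \<bar>\<delta>\<bar>" using pi_gt_zero by (intro mult_nonneg_nonneg) auto
    then show "- (pi / 2) \<le> pi * \<bar>\<delta>\<bar>" using pi_gt_zero by linarith
  qed
  moreover have "cos (pi * \<delta>) = cos (pi * \<bar>\<delta>\<bar>)" by (simp add: abs_if)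
  ultimately have "\<bar>\<delta>\<bar> * \<bar>cos (pi * \<delta>)\<bar> \<le> L * cos (pi * L)"
    using x_cos_pi_mono[of "\<bar>\<delta>\<bar>" L] assms by simp
  then have "\<bar>sine_coeff \<delta> k\<bar> \<le> (2 * L * cos (pi * L)) / (pi * ((real k + 1/2)\<^sup>2 - L\<^sup>2))"
    using coeff_frac_mono[OF assms, of "real k + 1/2" "cos (pi * \<delta>)" "cos (pi * L)" k]
    by (simp add: sine_coeff_def)
  also have "\<dots> = (-1) ^ k * sine_coeff L k" by (simp add: sine_coeff_def)
  finally show ?thesis .
qed

text \<open>
  The expansion of \<open>1 - cos (L t)\<close> at the end point \<open>t = \<pi>\<close>, where \<open>cos (k t) = (-1)\<^sup>k\<close> matches the signs
  of the coefficients. This evaluates Kadec's constant without the partial fractions of the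
  cotangent.
\<close>

lemma cosine_coeff_sums:
  assumes "0 \<le> L" "L \<le> 1/4"
  shows "(\<lambda>k. (-1) ^ k * cosine_coeff L k) sums (1 - cos (pi * L))"
  using cos_expansion[of L pi] assms by (simp add: mult.commute)

lemma sine_coeff_sums:
  assumes "0 \<le> L" "L \<le> 1/4"
  shows "(\<lambda>k. (-1) ^ k * sine_coeff L k) sums sin (pi * L)"
proof -
  have "sin ((real k + 1/2) * pi) = (-1) ^ k" for k
    by (simp add: distrib_right sin_add)
  then show ?thesis using sin_expansion[of L pi] assms by (simp add: mult.commute)
qed

definition bessel_L2 :: "'a measure \<Rightarrow> ('i \<Rightarrow> 'a \<Rightarrow> complex) \<Rightarrow> bool" where
  "bessel_L2 M e \<longleftrightarrow> (\<forall>n. e n \<in> space_L2 M) \<and>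
     (\<forall>w \<in> space_L2 M. \<forall>F. L2_set (\<lambda>n. cmod (inner_L2 M w (e n))) F \<le> norm_L2 M w)"

lemma orthonormal_imp_bessel:
  assumes "orthonormal_L2 M e"
  shows "bessel_L2 M e"
  unfolding bessel_L2_def
proof (intro conjI allI ballI)
  show "e n \<in> space_L2 M" for n using assms by (rule orthonormal_space)
  fix w F assume w: "w \<in> space_L2 M"
  show "L2_set (\<lambda>n. cmod (inner_L2 M w (e n))) F \<le> norm_L2 M w"
  proof (cases "finite F")
    case True
    show ?thesis unfolding L2_set_def
      by (rule real_le_lsqrt[OF _ Bessel_inequality[OF assms True w]]) simp
  qed simp
qed

lemma L2_set_cmod_sum:
  "L2_set (\<lambda>n. cmod (\<Sum>k\<in>I. f k n)) F \<le> (\<Sum>k\<in>I. L2_set (\<lambda>n. cmod (f k n)) F)"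
proof (induction I rule: infinite_finite_induct)
  case (insert k I)
  have "L2_set (\<lambda>n. cmod (\<Sum>k\<in>insert k I. f k n)) F
      \<le> L2_set (\<lambda>n. cmod (f k n) + cmod (\<Sum>k\<in>I. f k n)) F"
    using insert by (intro L2_set_mono) (auto intro: norm_triangle_ineq)
  also have "\<dots> \<le> L2_set (\<lambda>n. cmod (f k n)) F + L2_set (\<lambda>n. cmod (\<Sum>k\<in>I. f k n)) F"
    by (rule L2_set_triangle_ineq)
  finally show ?case using insert by simp
qed (simp_all add: L2_set_def)

lemma L2_set_cmod_add:
  "L2_set (\<lambda>n. cmod (f n + g n)) F \<le> L2_set (\<lambda>n. cmod (f n)) F + L2_set (\<lambda>n. cmod (g n)) F"
  by (rule order_trans[OF L2_set_mono L2_set_triangle_ineq]) (auto intro: norm_triangle_ineq)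

text \<open>
  The real multiplier \<open>\<phi>\<close> can be moved to \<open>w\<close>, where it does not increase the norm.
\<close>

lemma bessel_multiplier:
  assumes e: "bessel_L2 M e" and w: "w \<in> space_L2 M"
    and \<phi>: "\<phi> \<in> borel_measurable M" "\<And>x. \<bar>\<phi> x\<bar> \<le> 1"
    and c: "\<And>n. cmod (c n) \<le> P"
  shows "L2_set (\<lambda>n. cmod (inner_L2 M w (\<lambda>x. e n x * (c n * of_real (\<phi> x))))) F \<le> P * norm_L2 M w"
proof -
  let ?w = "\<lambda>x. w x * complex_of_real (\<phi> x)"
  have P: "0 \<le> P" using c[of undefined] norm_ge_zero order_trans by blast
  have ws: "?w \<in> space_L2 M"
    using \<phi> by (intro space_L2_mult_bounded[OF w, of _ 1]) auto
  have "inner_L2 M w (\<lambda>x. e n x * (c n * of_real (\<phi> x))) = cnj (c n) * inner_L2 M ?w (e n)" for n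
    unfolding inner_L2_cmult_right[symmetric] unfolding inner_L2_def
    by (simp add: mult_ac)
  then have "L2_set (\<lambda>n. cmod (inner_L2 M w (\<lambda>x. e n x * (c n * of_real (\<phi> x))))) F
      \<le> L2_set (\<lambda>n. P * cmod (inner_L2 M ?w (e n))) F"
    using c by (intro L2_set_mono) (auto simp: norm_mult intro: mult_right_mono)
  also have "\<dots> = P * L2_set (\<lambda>n. cmod (inner_L2 M ?w (e n))) F"
    using P by (rule L2_set_right_distrib[symmetric])
  also have "\<dots> \<le> P * norm_L2 M ?w"
    using e ws P unfolding bessel_L2_def by (intro mult_left_mono) auto
  also have "norm_L2 M ?w \<le> norm_L2 M w"
    using \<phi>(2) space_L2_measurable[OF ws]
    by (intro norm_L2_mono[OF w]) (auto simp: norm_mult mult_left_le)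
  finally show ?thesis using P by (simp add: mult_left_mono)
qed

text \<open>
  Kadec's argument: each term of the expansion of \<open>1 - exp (\<i> \<delta>\<^sub>n t)\<close> is a coefficient depending on \<open>n\<close>,
  bounded by its absolute value at \<open>L\<close>, times a real function of modulus at most \<open>1\<close>. The
  partial sums are estimated by \<open>bessel_multiplier\<close>; the limit is dominated, as the partial sums
  are bounded uniformly in \<open>n\<close> and \<open>x\<close>.
\<close>

lemma Kadec_estimate:
  fixes \<delta> :: "'i \<Rightarrow> real" and t :: "'a \<Rightarrow> real"
  assumes e: "bessel_L2 M e" and w: "w \<in> space_L2 M"
    and t: "t \<in> borel_measurable M" "\<And>x. x \<in> space M \<Longrightarrow> \<bar>t x\<bar> \<le> pi"
    and \<delta>: "\<And>n. \<bar>\<delta> n\<bar> \<le> L" and L: "L \<le> 1/4" and F: "finite F"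
  shows "L2_set (\<lambda>n. cmod (inner_L2 M w (\<lambda>x. e n x * (1 - cis (\<delta> n * t x))))) F
     \<le> (1 - cos (pi * L) + sin (pi * L)) * norm_L2 M w"
proof -
  define C where "C n k x = complex_of_real (cosine_coeff (\<delta> n) k) * of_real (cos (real k * t x))" for n k x
  define S where "S n k x = - \<i> * of_real (sine_coeff (\<delta> n) k) * of_real (sin ((real k + 1/2) * t x))" for n k x
  define U where "U n K x = (\<Sum>k<K. C n k x) + (\<Sum>k<K. S n k x)" for n K x
  define P where "P k = (-1) ^ k * cosine_coeff L k" for k
  define R where "R k = (-1) ^ k * sine_coeff L k" for k
  have L0: "0 \<le> L" using \<delta>[of undefined] by linarith
  have P: "P sums (1 - cos (pi * L))" and R: "R sums sin (pi * L)"
    unfolding P_def R_def using L0 L by (rule cosine_coeff_sums sine_coeff_sums)+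
  have CP: "\<bar>cosine_coeff (\<delta> n) k\<bar> \<le> P k" and SR: "\<bar>sine_coeff (\<delta> n) k\<bar> \<le> R k" for n k
    unfolding P_def R_def using \<delta>[of n] L by (rule cosine_coeff_mono sine_coeff_mono)+
  have P0: "0 \<le> P k" and R0: "0 \<le> R k" for k using CP[of undefined k] SR[of undefined k] by linarith+
  have Cb: "cmod (C n k x) \<le> P k" for n k x
    unfolding C_def norm_mult using mult_mono[OF CP[of n k] abs_cos_le_one P0] by simp
  have Sb: "cmod (S n k x) \<le> R k" for n k x
    unfolding S_def norm_mult using mult_mono[OF SR[of n k] abs_sin_le_one R0] by simp
  have sumP: "(\<Sum>k<K. P k) \<le> 1 - cos (pi * L)" for K
    using P P0 by (metis sum_le_suminf sums_iff finite_lessThan)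
  have sumR: "(\<Sum>k<K. R k) \<le> sin (pi * L)" for K
    using R R0 by (metis sum_le_suminf sums_iff finite_lessThan)
  have Ub: "cmod (U n K x) \<le> 3" for n K x
  proof -
    have "cmod (U n K x) \<le> (\<Sum>k<K. P k) + (\<Sum>k<K. R k)"
      unfolding U_def by (intro order_trans[OF norm_triangle_ineq] add_mono sum_norm_le Cb Sb)
    also have "\<dots> \<le> (1 - cos (pi * L)) + sin (pi * L)" by (intro add_mono sumP sumR)
    also have "\<dots> \<le> 3" using cos_ge_minus_one[of "pi * L"] sin_le_one[of "pi * L"] by linarith
    finally show ?thesis .
  qed
  have Cm: "C n k \<in> borel_measurable M" and Sm: "S n k \<in> borel_measurable M" for n k
    unfolding C_def S_def using t(1) by measurable
  then have Um: "U n K \<in> borel_measurable M" for n K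
    unfolding U_def by measurable
  have es: "e n \<in> space_L2 M" for n using e by (simp add: bessel_L2_def)
  have eC: "(\<lambda>x. e n x * C n k x) \<in> space_L2 M" and eS: "(\<lambda>x. e n x * S n k x) \<in> space_L2 M" for n k
    by (rule space_L2_mult_bounded[OF es Cm Cb], rule space_L2_mult_bounded[OF es Sm Sb])
  have Ulim: "(\<lambda>K. U n K x) \<longlonglongrightarrow> 1 - cis (\<delta> n * t x)" if x: "x \<in> space M" for n x
  proof -
    have d: "\<bar>\<delta> n\<bar> \<le> 1/4" using \<delta>[of n] L by linarith
    have "(\<lambda>k. of_real (cosine_coeff (\<delta> n) k * cos (real k * t x))) sums complex_of_real (1 - cos (\<delta> n * t x))"
      "(\<lambda>k. - \<i> * of_real (sine_coeff (\<delta> n) k * sin ((real k + 1/2) * t x))) sums (- \<i> * complex_of_real (sin (\<delta> n * t x)))"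
      using cos_expansion[OF d t(2)[OF x]] sin_expansion[OF d t(2)[OF x]]
      by (intro sums_mult sums_of_real; simp)+
    then have "(\<lambda>K. (\<Sum>k<K. C n k x) + (\<Sum>k<K. S n k x)) \<longlonglongrightarrow>
        complex_of_real (1 - cos (\<delta> n * t x)) + (- \<i> * of_real (sin (\<delta> n * t x)))"
      unfolding sums_def C_def S_def of_real_mult mult.assoc by (rule tendsto_add)
    moreover have "complex_of_real (1 - cos (\<delta> n * t x)) + (- \<i> * of_real (sin (\<delta> n * t x))) = 1 - cis (\<delta> n * t x)"
      by (simp add: complex_eq_iff)
    ultimately show ?thesis unfolding U_def by (simp only:)
  qed
  have partial: "L2_set (\<lambda>n. cmod (inner_L2 M w (\<lambda>x. e n x * U n K x))) F
     \<le> (1 - cos (pi * L) + sin (pi * L)) * norm_L2 M w" for K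
  proof -
    have "inner_L2 M w (\<lambda>x. e n x * U n K x)
        = (\<Sum>k<K. inner_L2 M w (\<lambda>x. e n x * C n k x)) + (\<Sum>k<K. inner_L2 M w (\<lambda>x. e n x * S n k x))" for n
      unfolding U_def distrib_left sum_distrib_left
      by (simp add: inner_L2_add_right inner_L2_sum_right space_L2_sum eC eS w)
    then have "L2_set (\<lambda>n. cmod (inner_L2 M w (\<lambda>x. e n x * U n K x))) F
       \<le> L2_set (\<lambda>n. cmod (\<Sum>k<K. inner_L2 M w (\<lambda>x. e n x * C n k x))) F
         + L2_set (\<lambda>n. cmod (\<Sum>k<K. inner_L2 M w (\<lambda>x. e n x * S n k x))) F"
      by (simp only: L2_set_cmod_add)
    also have "\<dots> \<le> (\<Sum>k<K. P k * norm_L2 M w) + (\<Sum>k<K. R k * norm_L2 M w)"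
    proof (intro add_mono order_trans[OF L2_set_cmod_sum] sum_mono)
      fix k
      have m: "(\<lambda>x. cos (real k * t x)) \<in> borel_measurable M" "(\<lambda>x. sin ((real k + 1/2) * t x)) \<in> borel_measurable M"
        using t(1) by measurable
      show "L2_set (\<lambda>n. cmod (inner_L2 M w (\<lambda>x. e n x * C n k x))) F \<le> P k * norm_L2 M w"
        unfolding C_def by (rule bessel_multiplier[OF e w m(1)]) (simp_all add: CP)
      show "L2_set (\<lambda>n. cmod (inner_L2 M w (\<lambda>x. e n x * S n k x))) F \<le> R k * norm_L2 M w"
        unfolding S_def by (rule bessel_multiplier[OF e w m(2)]) (simp_all add: norm_mult SR)
    qed
    also have "\<dots> = ((\<Sum>k<K. P k) + (\<Sum>k<K. R k)) * norm_L2 M w"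
      by (simp add: sum_distrib_right distrib_right)
    also have "\<dots> \<le> (1 - cos (pi * L) + sin (pi * L)) * norm_L2 M w"
      using sumP sumR by (intro mult_right_mono add_mono) auto
    finally show ?thesis .
  qed
  have "(\<lambda>K. inner_L2 M w (\<lambda>x. e n x * U n K x)) \<longlonglongrightarrow> inner_L2 M w (\<lambda>x. e n x * (1 - cis (\<delta> n * t x)))" for n
    unfolding inner_L2_def
  proof (rule integral_dominated_convergence)
    show "integrable M (\<lambda>x. cmod (w x) * cmod (e n x) * 3)"
      using integrable_L2_norm_mult[OF w es] by (rule integrable_mult_left)
    show "AE x in M. norm (w x * cnj (e n x * U n K x)) \<le> cmod (w x) * cmod (e n x) * 3" for K
      using Ub[of n K] by (intro AE_I2) (auto simp: norm_mult mult.assoc intro!: mult_left_mono)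
    show "AE x in M. (\<lambda>K. w x * cnj (e n x * U n K x)) \<longlonglongrightarrow> w x * cnj (e n x * (1 - cis (\<delta> n * t x)))"
      by (intro AE_I2 tendsto_intros Ulim)
    have "(\<lambda>x. cis (\<delta> n * t x)) \<in> borel_measurable M"
      using t(1) by (intro borel_measurable_continuous_on[of cis]) (auto intro!: continuous_intros)
    then show "(\<lambda>x. w x * cnj (e n x * (1 - cis (\<delta> n * t x)))) \<in> borel_measurable M"
      using space_L2_measurable[OF w] space_L2_measurable[OF es[of n]] by measurable
    show "(\<lambda>x. w x * cnj (e n x * U n K x)) \<in> borel_measurable M" for K
      using space_L2_measurable[OF w] space_L2_measurable[OF es[of n]] Um[of n K] by measurable
  qed
  then have "(\<lambda>K. L2_set (\<lambda>n. cmod (inner_L2 M w (\<lambda>x. e n x * U n K x))) F)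
     \<longlonglongrightarrow> L2_set (\<lambda>n. cmod (inner_L2 M w (\<lambda>x. e n x * (1 - cis (\<delta> n * t x))))) F"
    unfolding L2_set_def by (intro tendsto_intros)
  then show ?thesis by (rule LIMSEQ_le_const2) (use partial in blast)
qed

lemma Kadec_upper_estimate:
  fixes \<delta> :: "'i \<Rightarrow> real" and t :: "'a \<Rightarrow> real"
  assumes e: "bessel_L2 M e" and w: "w \<in> space_L2 M"
    and t: "t \<in> borel_measurable M" "\<And>x. x \<in> space M \<Longrightarrow> \<bar>t x\<bar> \<le> pi"
    and \<delta>: "\<And>n. \<bar>\<delta> n\<bar> \<le> L" and L: "L \<le> 1/4" and F: "finite F"
  shows "L2_set (\<lambda>n. cmod (inner_L2 M w (\<lambda>x. e n x * cis (\<delta> n * t x)))) F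
     \<le> (2 - cos (pi * L) + sin (pi * L)) * norm_L2 M w"
proof -
  have es: "e n \<in> space_L2 M" for n using e by (simp add: bessel_L2_def)
  have m: "(\<lambda>x. 1 - cis (\<delta> n * t x)) \<in> borel_measurable M" for n
    using t(1) by (intro borel_measurable_diff borel_measurable_continuous_on[of cis]) (auto intro!: continuous_intros)
  have d: "(\<lambda>x. e n x * (1 - cis (\<delta> n * t x))) \<in> space_L2 M" for n
  proof (rule space_L2_mult_bounded[OF es m])
    show "cmod (1 - cis (\<delta> n * t x)) \<le> 2" for x
      using norm_triangle_ineq4[of 1 "cis (\<delta> n * t x)"] by simp
  qed
  have "inner_L2 M w (\<lambda>x. e n x * cis (\<delta> n * t x))
      = inner_L2 M w (e n) + - inner_L2 M w (\<lambda>x. e n x * (1 - cis (\<delta> n * t x)))" for n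
  proof -
    have "(\<lambda>x. e n x * cis (\<delta> n * t x)) = (\<lambda>x. e n x - e n x * (1 - cis (\<delta> n * t x)))"
      by (simp add: fun_eq_iff right_diff_distrib)
    then show ?thesis using inner_L2_diff_right[OF es[of n] d[of n] w] by simp
  qed
  then have "L2_set (\<lambda>n. cmod (inner_L2 M w (\<lambda>x. e n x * cis (\<delta> n * t x)))) F
     \<le> L2_set (\<lambda>n. cmod (inner_L2 M w (e n))) F
       + L2_set (\<lambda>n. cmod (- inner_L2 M w (\<lambda>x. e n x * (1 - cis (\<delta> n * t x))))) F"
    by (simp only: L2_set_cmod_add)
  also have "\<dots> \<le> norm_L2 M w + (1 - cos (pi * L) + sin (pi * L)) * norm_L2 M w"
    unfolding norm_minus_cancel using e w
    by (intro add_mono Kadec_estimate assms) (auto simp: bessel_L2_def)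
  finally show ?thesis by (simp add: algebra_simps)
qed

section \<open>Measure preserving maps and the Paley--Wiener criterion\<close>

text \<open>
  A measure preserving map \<open>\<phi>\<close> induces an isometry \<open>f \<mapsto> f \<circ> \<phi>\<close>. Hence a system inherits
  orthonormality and Parseval's identity from the system that is composed with \<open>\<phi>\<close>.
\<close>

lemma pullback_space_L2:
  assumes \<phi>: "\<phi> \<in> measurable M N" "distr M N \<phi> = N" and f: "f \<in> space_L2 N"
  shows "(\<lambda>x. f (\<phi> x)) \<in> space_L2 M"
proof -
  have "integrable (distr M N \<phi>) (\<lambda>x. (cmod (f x))\<^sup>2)"
    using space_L2_integrable[OF f] \<phi>(2) by simp
  then have "integrable M (\<lambda>x. (cmod (f (\<phi> x)))\<^sup>2)"
    using \<phi>(1) by (rule integrable_distr[rotated])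
  moreover have "(\<lambda>x. f (\<phi> x)) \<in> borel_measurable M"
    using \<phi>(1) space_L2_measurable[OF f] by (rule measurable_compose)
  ultimately show ?thesis by (simp add: space_L2_def)
qed

lemma pullback_inner_L2:
  assumes \<phi>: "\<phi> \<in> measurable M N" "distr M N \<phi> = N" and f: "f \<in> space_L2 N" and g: "g \<in> space_L2 N"
  shows "inner_L2 N f g = inner_L2 M (\<lambda>x. f (\<phi> x)) (\<lambda>x. g (\<phi> x))"
proof -
  have "inner_L2 N f g = integral\<^sup>L (distr M N \<phi>) (\<lambda>x. f x * cnj (g x))"
    using \<phi>(2) by (simp add: inner_L2_def)
  also have "\<dots> = inner_L2 M (\<lambda>x. f (\<phi> x)) (\<lambda>x. g (\<phi> x))"
    unfolding inner_L2_def using integrable_inner_L2[OF f g] \<phi>(1) by (intro integral_distr) auto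
  finally show ?thesis .
qed

lemma pullback_norm_L2:
  assumes \<phi>: "\<phi> \<in> measurable M N" "distr M N \<phi> = N" and f: "f \<in> space_L2 N"
  shows "norm_L2 N f = norm_L2 M (\<lambda>x. f (\<phi> x))"
proof -
  have "complex_of_real ((norm_L2 N f)\<^sup>2) = complex_of_real ((norm_L2 M (\<lambda>x. f (\<phi> x)))\<^sup>2)"
    unfolding inner_L2_self[symmetric] by (rule pullback_inner_L2[OF assms f])
  then show ?thesis using of_real_eq_iff norm_L2_nonneg power2_eq_iff_nonneg by metis
qed

lemma pullback_orthonormal:
  assumes \<phi>: "\<phi> \<in> measurable M N" "distr M N \<phi> = N"
    and e: "\<And>n. e n \<in> space_L2 N" and "orthonormal_L2 M (\<lambda>n x. e n (\<phi> x))"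
  shows "orthonormal_L2 N e"
  using assms(4) e unfolding orthonormal_L2_def by (simp add: pullback_inner_L2[OF \<phi>])

lemma pullback_parseval:
  assumes \<phi>: "\<phi> \<in> measurable M N" "distr M N \<phi> = N"
    and e: "\<And>n. e n \<in> space_L2 N" and "parseval_L2 M (\<lambda>n x. e n (\<phi> x))"
  shows "parseval_L2 N e"
  unfolding parseval_L2_def
proof (intro ballI)
  fix w assume w: "w \<in> space_L2 N"
  show "\<forall>\<epsilon>>0. \<exists>F. finite F \<and> (norm_L2 N w)\<^sup>2 - \<epsilon> \<le> (\<Sum>n\<in>F. (cmod (inner_L2 N w (e n)))\<^sup>2)"
    using bspec[OF assms(4)[unfolded parseval_L2_def] pullback_space_L2[OF \<phi> w]]
    unfolding pullback_inner_L2[OF \<phi> w e] pullback_norm_L2[OF \<phi> w] .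
qed

text \<open>
  The coefficient sequences of \<open>w\<close> with respect to \<open>v\<close> and to the orthonormal basis \<open>e\<close> differ, up to
  unimodular factors, by at most \<open>q \<parallel>w\<parallel>\<close> in \<open>\<ell>\<^sup>2\<close>, and the latter has norm \<open>\<parallel>w\<parallel>\<close>: this gives the frame
  bounds \<open>(1 - q)\<^sup>2\<close> and \<open>(1 + q)\<^sup>2\<close>. For finite combinations the difference \<open>r\<close> is tested against
  itself: \<open>\<parallel>r\<parallel>\<^sup>2 = \<langle>r, r\<rangle>\<close> is at most \<open>\<parallel>c\<parallel> q \<parallel>r\<parallel>\<close> by the hypothesis for \<open>w = r\<close>.
\<close>

theorem Paley_Wiener_riesz_basis:
  assumes e: "orthonormal_L2 M e" "parseval_L2 M e"
    and v: "\<And>n. v n \<in> space_L2 M" and \<sigma>: "\<And>n. cmod (\<sigma> n) = 1" and q: "0 \<le> q" "q < 1"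
    and close: "\<And>w F. w \<in> space_L2 M \<Longrightarrow> finite F \<Longrightarrow>
      L2_set (\<lambda>n. cmod (inner_L2 M w (v n) - \<sigma> n * inner_L2 M w (e n))) F \<le> q * norm_L2 M w"
  shows "riesz_basis_L2 M v"
proof -
  have es: "e n \<in> space_L2 M" for n by (rule orthonormal_space[OF e(1)])
  have sums: "(1 - q)\<^sup>2 * (\<Sum>n\<in>F. (cmod (c n))\<^sup>2) \<le> (norm_L2 M (\<lambda>x. \<Sum>n\<in>F. c n * v n x))\<^sup>2 \<and>
      (norm_L2 M (\<lambda>x. \<Sum>n\<in>F. c n * v n x))\<^sup>2 \<le> (1 + q)\<^sup>2 * (\<Sum>n\<in>F. (cmod (c n))\<^sup>2)"
    if F: "finite F" for F c
  proof -
    define d where "d n x = v n x - cnj (\<sigma> n) * e n x" for n x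
    define W where "W x = (\<Sum>n\<in>F. c n * v n x)" for x
    define u where "u x = (\<Sum>n\<in>F. (c n * cnj (\<sigma> n)) * e n x)" for x
    define r where "r x = (\<Sum>n\<in>F. c n * d n x)" for x
    have ds: "d n \<in> space_L2 M" for n
      unfolding d_def by (intro space_L2_diff space_L2_cmult v es)
    have Ws: "W \<in> space_L2 M" and us: "u \<in> space_L2 M" and rs: "r \<in> space_L2 M"
      unfolding W_def u_def r_def by (intro space_L2_sum space_L2_cmult v es ds)+
    let ?c = "L2_set (\<lambda>n. cmod (c n)) F"
    have csq: "?c\<^sup>2 = (\<Sum>n\<in>F. (cmod (c n))\<^sup>2)"
      unfolding L2_set_def by (simp add: sum_nonneg)
    have "(norm_L2 M u)\<^sup>2 = ?c\<^sup>2"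
      unfolding u_def csq norm_orthonormal_sum[OF e(1) F] by (simp add: norm_mult \<sigma>)
    then have nu: "norm_L2 M u = ?c" by (simp add: power2_eq_iff_nonneg)
    have id: "inner_L2 M r (d n) = inner_L2 M r (v n) - \<sigma> n * inner_L2 M r (e n)" for n
      unfolding d_def by (subst inner_L2_diff_right) (simp_all add: v es rs space_L2_cmult inner_L2_cmult_right)
    have "(norm_L2 M r)\<^sup>2 = cmod (inner_L2 M r r)"
      unfolding inner_L2_self by (simp only: norm_of_real abs_power2)
    also have "inner_L2 M r r = (\<Sum>n\<in>F. cnj (c n) * inner_L2 M r (d n))"
    proof -
      have "inner_L2 M r (\<lambda>x. \<Sum>n\<in>F. c n * d n x) = (\<Sum>n\<in>F. cnj (c n) * inner_L2 M r (d n))"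
        by (simp add: inner_L2_sum_right inner_L2_cmult_right space_L2_cmult ds rs)
      then show ?thesis by (simp add: r_def[abs_def])
    qed
    also have "cmod \<dots> \<le> (\<Sum>n\<in>F. \<bar>cmod (c n)\<bar> * \<bar>cmod (inner_L2 M r (d n))\<bar>)"
      by (rule order_trans[OF norm_sum]) (simp add: norm_mult)
    also have "\<dots> \<le> ?c * L2_set (\<lambda>n. cmod (inner_L2 M r (d n))) F"
      by (rule L2_set_mult_ineq)
    also have "\<dots> \<le> ?c * (q * norm_L2 M r)"
      unfolding id by (intro mult_left_mono close rs F) simp
    finally have r2: "(norm_L2 M r)\<^sup>2 \<le> ?c * (q * norm_L2 M r)" .
    have nr: "norm_L2 M r \<le> q * ?c"
    proof (cases "norm_L2 M r = 0")
      case True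
      then show ?thesis using q by simp
    next
      case False
      then have "norm_L2 M r > 0" using norm_L2_nonneg[of M r] by linarith
      then show ?thesis using r2 by (simp add: power2_eq_square mult_ac)
    qed
    have Weq: "W = (\<lambda>x. u x + r x)"
      by (auto simp: W_def u_def r_def d_def sum.distrib[symmetric] algebra_simps)
    have up: "norm_L2 M W \<le> (1 + q) * ?c"
      using norm_L2_triangle[OF us rs] nu nr unfolding Weq by (simp add: distrib_right)
    have "norm_L2 M u \<le> norm_L2 M W + norm_L2 M r"
      using norm_L2_triangle[OF Ws space_L2_cmult[OF rs, of "-1"]] norm_L2_cmult[of M "-1" r]
      by (simp add: Weq)
    then have lo: "(1 - q) * ?c \<le> norm_L2 M W" using nu nr by (simp add: left_diff_distrib)
    have "((1 - q) * ?c)\<^sup>2 \<le> (norm_L2 M W)\<^sup>2" "(norm_L2 M W)\<^sup>2 \<le> ((1 + q) * ?c)\<^sup>2"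
      using up lo q by (intro power_mono; simp)+
    then show ?thesis unfolding power_mult_distrib csq W_def by simp
  qed
  have frame: "(\<lambda>n. (cmod (inner_L2 M w (v n)))\<^sup>2) summable_on UNIV \<and>
      (1 - q)\<^sup>2 * (norm_L2 M w)\<^sup>2 \<le> (\<Sum>\<^sub>\<infinity>n. (cmod (inner_L2 M w (v n)))\<^sup>2) \<and>
      (\<Sum>\<^sub>\<infinity>n. (cmod (inner_L2 M w (v n)))\<^sup>2) \<le> (1 + q)\<^sup>2 * (norm_L2 M w)\<^sup>2"
    if w: "w \<in> space_L2 M" for w
  proof -
    let ?N = "norm_L2 M w"
    let ?a = "\<lambda>n. inner_L2 M w (v n)" and ?b = "\<lambda>n. \<sigma> n * inner_L2 M w (e n)"
    let ?I = "\<Sum>\<^sub>\<infinity>n. (cmod (?a n))\<^sup>2"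
    have bF: "L2_set (\<lambda>n. cmod (?b n)) F = L2_set (\<lambda>n. cmod (inner_L2 M w (e n))) F" for F
      by (simp add: norm_mult \<sigma>)
    have fin: "(\<Sum>n\<in>F. (cmod (?a n))\<^sup>2) \<le> (1 + q)\<^sup>2 * ?N\<^sup>2" if F: "finite F" for F
    proof -
      have "L2_set (\<lambda>n. cmod (?a n)) F \<le> L2_set (\<lambda>n. cmod (?b n)) F + L2_set (\<lambda>n. cmod (?a n - ?b n)) F"
        using L2_set_cmod_add[of ?b "\<lambda>n. ?a n - ?b n" F] by simp
      also have "\<dots> \<le> ?N + q * ?N"
        unfolding bF using orthonormal_imp_bessel[OF e(1)] w F
        by (intro add_mono close) (auto simp: bessel_L2_def)
      finally have "(L2_set (\<lambda>n. cmod (?a n)) F)\<^sup>2 \<le> ((1 + q) * ?N)\<^sup>2"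
        by (intro power_mono) (simp_all add: distrib_right)
      then show ?thesis unfolding L2_set_def by (simp add: sum_nonneg power_mult_distrib)
    qed
    have summ: "(\<lambda>n. (cmod (?a n))\<^sup>2) summable_on UNIV"
      by (rule nonneg_bdd_above_summable_on) (auto intro!: bdd_aboveI2 fin)
    have up: "?I \<le> (1 + q)\<^sup>2 * ?N\<^sup>2"
      using summ fin by (intro infsum_le_finite_sums) auto
    have I0: "0 \<le> ?I" by (intro infsum_nonneg) auto
    have "?N\<^sup>2 \<le> (sqrt ?I + q * ?N)\<^sup>2"
    proof (rule field_le_epsilon)
      fix \<epsilon> :: real assume "\<epsilon> > 0"
      then obtain F where F: "finite F" "?N\<^sup>2 - \<epsilon> \<le> (\<Sum>n\<in>F. (cmod (inner_L2 M w (e n)))\<^sup>2)"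
        using e(2) w unfolding parseval_L2_def by blast
      have "(\<Sum>n\<in>F. (cmod (?a n))\<^sup>2) \<le> ?I"
        using summ F(1) by (intro finite_sum_le_infsum) auto
      then have aF: "L2_set (\<lambda>n. cmod (?a n)) F \<le> sqrt ?I"
        unfolding L2_set_def by (rule real_sqrt_le_mono)
      have "L2_set (\<lambda>n. cmod (?b n)) F
          \<le> L2_set (\<lambda>n. cmod (?a n)) F + L2_set (\<lambda>n. cmod (- (?a n - ?b n))) F"
        using L2_set_cmod_add[of ?a "\<lambda>n. - (?a n - ?b n)" F] by simp
      also have "\<dots> \<le> sqrt ?I + q * ?N"
        unfolding norm_minus_cancel by (intro add_mono aF close w F)
      finally have "(L2_set (\<lambda>n. cmod (inner_L2 M w (e n))) F)\<^sup>2 \<le> (sqrt ?I + q * ?N)\<^sup>2"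
        unfolding bF by (intro power_mono) auto
      then have "(\<Sum>n\<in>F. (cmod (inner_L2 M w (e n)))\<^sup>2) \<le> (sqrt ?I + q * ?N)\<^sup>2"
        unfolding L2_set_def by (simp add: sum_nonneg)
      then show "?N\<^sup>2 \<le> (sqrt ?I + q * ?N)\<^sup>2 + \<epsilon>" using F(2) by linarith
    qed
    moreover have "0 \<le> sqrt ?I + q * ?N"
      by (intro add_nonneg_nonneg mult_nonneg_nonneg real_sqrt_ge_zero I0 q norm_L2_nonneg)
    ultimately have "?N \<le> sqrt ?I + q * ?N"
      by (rule power2_le_imp_le)
    then have "(1 - q) * ?N \<le> sqrt ?I" by (simp add: left_diff_distrib)
    then have "((1 - q) * ?N)\<^sup>2 \<le> (sqrt ?I)\<^sup>2" using q by (intro power_mono) auto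
    then have "(1 - q)\<^sup>2 * ?N\<^sup>2 \<le> ?I" using I0 by (simp add: power_mult_distrib)
    with summ up show ?thesis by blast
  qed
  have "(1 - q)\<^sup>2 > 0" "(1 + q)\<^sup>2 > 0" using q by auto
  then show ?thesis
    unfolding riesz_basis_L2_def using v sums frame by blast
qed

section \<open>Comparison of Kadec constants\<close>

text \<open>
  Each bound follows from the preceding one, since it compares the derivatives.
\<close>

lemma sin_cos_Taylor_bounds:
  assumes "0 \<le> (x::real)"
  shows "1 - x^2/2 \<le> cos x" "x - x^3/6 \<le> sin x"
    "cos x \<le> 1 - x^2/2 + x^4/24" "sin x \<le> x - x^3/6 + x^5/120"
proof -
  have d: "\<exists>d. (f has_real_derivative d) (at y) \<and> 0 \<le> d" if "(f has_real_derivative d) (at y)" "0 \<le> d" for f d y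
    using that by blast
  have c1: "0 \<le> y - sin y" if "0 \<le> y" for y :: real using sin_x_le_x[OF that] by simp
  have c2: "1 - y^2/2 \<le> cos y" if "0 \<le> y" for y :: real
  proof -
    have "(cos 0 - (1 - 0^2/2)) \<le> cos y - (1 - y^2/2)"
    proof (rule DERIV_nonneg_imp_nondecreasing[where f = "\<lambda>y. cos y - (1 - y^2/2)", OF that])
      fix z :: real assume "0 \<le> z" "z \<le> y"
      show "\<exists>d. ((\<lambda>y. cos y - (1 - y^2/2)) has_real_derivative d) (at z) \<and> 0 \<le> d"
        by (rule d[of _ "z - sin z"]) (use c1[OF \<open>0 \<le> z\<close>] in \<open>auto intro!: derivative_eq_intros\<close>)
    qed
    then show ?thesis by simp
  qed
  have c3: "y - y^3/6 \<le> sin y" if "0 \<le> y" for y :: real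
  proof -
    have "(sin 0 - (0 - 0^3/6)) \<le> sin y - (y - y^3/6)"
    proof (rule DERIV_nonneg_imp_nondecreasing[where f = "\<lambda>y. sin y - (y - y^3/6)", OF that])
      fix z :: real assume "0 \<le> z" "z \<le> y"
      show "\<exists>d. ((\<lambda>y. sin y - (y - y^3/6)) has_real_derivative d) (at z) \<and> 0 \<le> d"
        by (rule d[of _ "cos z - (1 - z^2/2)"]) (use c2[OF \<open>0 \<le> z\<close>] in \<open>auto intro!: derivative_eq_intros\<close>)
    qed
    then show ?thesis by simp
  qed
  have c4: "cos y \<le> 1 - y^2/2 + y^4/24" if "0 \<le> y" for y :: real
  proof -
    have "(1 - 0^2/2 + 0^4/24) - cos 0 \<le> (1 - y^2/2 + y^4/24) - cos y"
    proof (rule DERIV_nonneg_imp_nondecreasing[where f = "\<lambda>y. (1 - y^2/2 + y^4/24) - cos y", OF that])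
      fix z :: real assume "0 \<le> z" "z \<le> y"
      show "\<exists>d. ((\<lambda>y. (1 - y^2/2 + y^4/24) - cos y) has_real_derivative d) (at z) \<and> 0 \<le> d"
        by (rule d[of _ "sin z - (z - z^3/6)"]) (use c3[OF \<open>0 \<le> z\<close>] in \<open>auto intro!: derivative_eq_intros\<close>)
    qed
    then show ?thesis by simp
  qed
  have c5: "sin y \<le> y - y^3/6 + y^5/120" if "0 \<le> y" for y :: real
  proof -
    have "(0 - 0^3/6 + 0^5/120) - sin 0 \<le> (y - y^3/6 + y^5/120) - sin y"
    proof (rule DERIV_nonneg_imp_nondecreasing[where f = "\<lambda>y. (y - y^3/6 + y^5/120) - sin y", OF that])
      fix z :: real assume "0 \<le> z" "z \<le> y"
      show "\<exists>d. ((\<lambda>y. (y - y^3/6 + y^5/120) - sin y) has_real_derivative d) (at z) \<and> 0 \<le> d"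
        by (rule d[of _ "(1 - z^2/2 + z^4/24) - cos z"]) (use c4[OF \<open>0 \<le> z\<close>] in \<open>auto intro!: derivative_eq_intros\<close>)
    qed
    then show ?thesis by simp
  qed
  show "1 - x^2/2 \<le> cos x" "x - x^3/6 \<le> sin x"
    "cos x \<le> 1 - x^2/2 + x^4/24" "sin x \<le> x - x^3/6 + x^5/120"
    using c2 c3 c4 c5 assms by auto
qed

text \<open>
  If \<open>\<pi>\<close> were larger, the cosine would still be nonnegative at \<open>8/5\<close>, against its Taylor bound.
\<close>

lemma pi_less_16_5: "pi < 16/5"
proof (rule ccontr)
  assume "\<not> pi < 16/5"
  then have "0 \<le> cos (8/5::real)" by (intro cos_ge_zero) auto
  moreover have "cos (8/5::real) \<le> 1 - (8/5)^2/2 + (8/5)^4/24"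
    by (rule sin_cos_Taylor_bounds) simp
  ultimately show False by (simp add: power_divide)
qed

text \<open>
  Near \<open>0\<close> the left side is \<open>1 + 4 t\<close> and the right side \<open>1 + (9/2) t\<close> to first order. The range of \<open>t\<close>
  is small enough for cubic polynomials \<open>?k\<close> and \<open>?b\<close> to separate the two sides; in these the
  higher Taylor terms are absorbed in the cubic one by \<open>t \<le> 2/5\<close>.
\<close>

lemma Kadec_constant_double_angle:
  assumes t: "0 \<le> t" "t \<le> (2/5::real)"
  shows "(2 - cos (2 * t) + sin (2 * t))\<^sup>2 \<le> (1 + 5/2 * t) * (2 - cos t + sin t)\<^sup>2"
proof -
  let ?k = "1 + 2 * t + 2 * t^2 - 129/100 * t^3" and ?b = "1 + t + t^2/2 - 19/100 * t^3"
  have t2: "t^2 \<le> 4/25" using power_mono[OF t(2,1), of 2] by (simp add: power_divide)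
  have t3: "0 \<le> t^3" and t5: "t^5 \<le> 4/25 * t^3" and t4: "t^4 \<le> 2/5 * t^3" and t32: "t^3 \<le> 4/25 * t"
    using t mult_right_mono[OF t2, of "t^3"] mult_right_mono[OF t(2), of "t^3"] mult_right_mono[OF t2, of t]
    by (simp_all add: power_add[symmetric] flip: power_Suc power_Suc2 add: eval_nat_numeral)
  have K: "2 - cos (2 * t) + sin (2 * t) \<le> ?k"
  proof -
    have "1 - 2 * t^2 \<le> cos (2 * t)" "sin (2 * t) \<le> 2 * t - 4 * t^3 / 3 + 4 * t^5 / 15"
      using sin_cos_Taylor_bounds(1,4)[of "2 * t"] t by (simp_all add: power_mult_distrib)
    then show ?thesis using t3 t5 by linarith
  qed
  have B: "?b \<le> 2 - cos t + sin t"
    using sin_cos_Taylor_bounds(2,3)[OF t(1)] t3 t4 by linarith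
  have K0: "0 \<le> 2 - cos (2 * t) + sin (2 * t)"
    using cos_le_one[of "2 * t"] sin_ge_minus_one[of "2 * t"] by linarith
  have B0: "0 \<le> ?b"
    using t t32 zero_le_power2[of t] by linarith
  have "(2 - cos (2 * t) + sin (2 * t))\<^sup>2 \<le> ?k\<^sup>2" using K K0 by (rule power_mono)
  also have "\<dots> \<le> (1 + 5/2 * t) * ?b\<^sup>2"
  proof -
    \<comment> \<open>Expanded and grouped so that every summand is visibly nonnegative for \<open>t \<le> 2/5\<close>.\<close>
    have "(1 + 5/2 * t) * ?b\<^sup>2 - ?k\<^sup>2
      = t * (1/2 - t) + 1/5 * t^3 + 129/50 * t^4 + t^5 * (929/200 - 2103/1000 * t) + 361/4000 * t^7"
      by (simp add: power2_eq_square eval_nat_numeral field_simps)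
    moreover have "0 \<le> \<dots>" using t by (intro add_nonneg_nonneg mult_nonneg_nonneg) auto
    ultimately show ?thesis by linarith
  qed
  also have "\<dots> \<le> (1 + 5/2 * t) * (2 - cos t + sin t)\<^sup>2"
    using t B B0 by (intro mult_left_mono power_mono) auto
  finally show ?thesis .
qed

text \<open>
  With \<open>t = \<pi> \<gamma> L \<le> \<pi> \<gamma> / 4\<close> the factor \<open>1 + 5 t / 2\<close> of the preceding lemma is at most \<open>1 + 2 \<gamma>\<close>,
  because \<open>\<pi> < 16/5\<close>.
\<close>

lemma Kadec_constant_half_length:
  assumes "0 \<le> \<gamma>" "2 * \<gamma> \<le> 1" "0 \<le> L" "L \<le> 1/4"
  shows "(2 - cos (pi * (2 * \<gamma> * L)) + sin (pi * (2 * \<gamma> * L)))\<^sup>2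
     \<le> (1 + 2 * \<gamma>) * (2 - cos (pi * \<gamma> * L) + sin (pi * \<gamma> * L))\<^sup>2"
proof -
  let ?t = "pi * \<gamma> * L"
  have "?t \<le> 16/5 * \<gamma> * (1/4)" using assms pi_less_16_5 by (intro mult_mono) auto
  then have t: "0 \<le> ?t" "?t \<le> 4/5 * \<gamma>" using assms by auto
  have "(2 - cos (2 * ?t) + sin (2 * ?t))\<^sup>2 \<le> (1 + 5/2 * ?t) * (2 - cos ?t + sin ?t)\<^sup>2"
    using t assms by (intro Kadec_constant_double_angle) auto
  also have "\<dots> \<le> (1 + 2 * \<gamma>) * (2 - cos ?t + sin ?t)\<^sup>2"
    using t by (intro mult_right_mono) auto
  finally show ?thesis by (simp add: mult_ac)
qed

section \<open>Intervals moved by integers\<close>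

lemma borel_measurable_lebesgue_on:
  "f \<in> borel_measurable borel \<Longrightarrow> f \<in> borel_measurable (lebesgue_on S)"
  by (rule measurable_restrict_space1, rule measurable_completion) simp

text \<open>
  The unit interval is cut at the points \<open>a j\<close>, and the \<open>j\<close>th piece is moved to the right by \<open>b j\<close>.
  Weak monotonicity of \<open>b\<close> keeps the moved pieces disjoint.
\<close>

locale interval_exchange =
  fixes m :: nat and a :: "nat \<Rightarrow> real" and b :: "nat \<Rightarrow> nat"
  assumes a_0: "a 0 = 0" and a_m: "a m = 1" and a_step: "j < m \<Longrightarrow> a j < a (Suc j)"
    and b_step: "Suc j < m \<Longrightarrow> b j \<le> b (Suc j)"
begin

definition piece :: "nat \<Rightarrow> real set" where "piece j = {a j ..< a (Suc j)}"

definition moved :: "nat \<Rightarrow> real set" where "moved j = {a j + real (b j) ..< a (Suc j) + real (b j)}"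

definition J :: "real set" where "J = (\<Union>j<m. moved j)"

definition shift :: "real \<Rightarrow> real" where "shift y = y + (\<Sum>j<m. indicator (piece j) y * real (b j))"

definition offset :: "real \<Rightarrow> real" where "offset x = (\<Sum>j<m. indicator (moved j) x * real (b j))"

lemma a_mono: "i \<le> j \<Longrightarrow> j \<le> m \<Longrightarrow> a i \<le> a j"
proof (induction j rule: dec_induct)
  case (step n)
  then show ?case using a_step[of n] by auto
qed simp

lemma b_mono: "i \<le> j \<Longrightarrow> j < m \<Longrightarrow> b i \<le> b j"
proof (induction j rule: dec_induct)
  case (step n)
  then show ?case using b_step[of n] by auto
qed simp

lemma piece_unique: "y \<in> piece i \<Longrightarrow> y \<in> piece j \<Longrightarrow> i < m \<Longrightarrow> j < m \<Longrightarrow> i = j"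
proof (induction i j rule: linorder_wlog)
  case (le i j)
  show ?case
  proof (rule ccontr)
    assume "i \<noteq> j"
    then have "a (Suc i) \<le> a j" using le by (intro a_mono) auto
    then show False using le by (auto simp: piece_def)
  qed
qed simp

lemma moved_unique: "x \<in> moved i \<Longrightarrow> x \<in> moved j \<Longrightarrow> i < m \<Longrightarrow> j < m \<Longrightarrow> i = j"
proof (induction i j rule: linorder_wlog)
  case (le i j)
  show ?case
  proof (rule ccontr)
    assume "i \<noteq> j"
    then have "a (Suc i) \<le> a j" using le by (intro a_mono) auto
    moreover have "real (b i) \<le> real (b j)" using le by (intro of_nat_mono b_mono)
    ultimately show False using le by (auto simp: moved_def)
  qed
qed simp

lemma pieces_cover: "(\<Union>j<m. piece j) = {0..<1}"
proof -
  have "k \<le> m \<Longrightarrow> (\<Union>j<k. piece j) = {a 0..<a k}" for k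
  proof (induction k)
    case (Suc k)
    have "(\<Union>j<Suc k. piece j) = {a 0..<a k} \<union> {a k..<a (Suc k)}"
      using Suc by (auto simp: lessThan_Suc piece_def)
    also have "\<dots> = {a 0..<a (Suc k)}"
      using Suc.prems a_mono[of 0 k] a_step[of k] by (intro ivl_disj_un_two(3)) auto
    finally show ?case .
  qed simp
  then show ?thesis by (simp add: a_0 a_m)
qed

lemma shift_piece: "j < m \<Longrightarrow> y \<in> piece j \<Longrightarrow> shift y = y + real (b j)"
proof -
  assume j: "j < m" "y \<in> piece j"
  have "(\<Sum>i<m. indicator (piece i) y * real (b i)) = (\<Sum>i<m. if i = j then real (b j) else 0)"
  proof (rule sum.cong)
    fix i assume i: "i \<in> {..<m}"
    show "indicator (piece i) y * real (b i) = (if i = j then real (b j) else 0)"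
    proof (cases "i = j")
      case False
      then have "y \<notin> piece i" using piece_unique j i by blast
      then show ?thesis using False by simp
    qed (use j in simp)
  qed simp
  then show ?thesis using j by (simp add: shift_def)
qed

lemma offset_moved: "j < m \<Longrightarrow> x \<in> moved j \<Longrightarrow> offset x = real (b j)"
proof -
  assume j: "j < m" "x \<in> moved j"
  have "(\<Sum>i<m. indicator (moved i) x * real (b i)) = (\<Sum>i<m. if i = j then real (b j) else 0)"
  proof (rule sum.cong)
    fix i assume i: "i \<in> {..<m}"
    show "indicator (moved i) x * real (b i) = (if i = j then real (b j) else 0)"
    proof (cases "i = j")
      case False
      then have "x \<notin> moved i" using moved_unique j i by blast
      then show ?thesis using False by simp
    qed (use j in simp)
  qed simp
  then show ?thesis using j by (simp add: offset_def)
qed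

lemma shift_int: "\<exists>k::int. shift y = y + of_int k"
proof
  show "shift y = y + of_int (\<Sum>j<m. indicator (piece j) y * int (b j))"
    by (auto simp: shift_def indicator_def intro!: sum.cong)
qed

lemma moved_sets: "moved j \<in> sets lebesgue"
  by (simp add: moved_def)

lemma J_lmeasurable: "J \<in> lmeasurable"
proof (rule bounded_set_imp_lmeasurable)
  show "bounded J" by (auto simp: J_def moved_def)
  show "J \<in> sets lebesgue" unfolding J_def by (intro sets.finite_UN moved_sets) auto
qed

lemma J_sets: "J \<in> sets lebesgue"
  using J_lmeasurable by (rule fmeasurableD)

lemma shift_vimage:
  assumes "A \<subseteq> J"
  shows "shift -` A \<inter> {0..<1} = (\<Union>j<m. (\<lambda>x. - real (b j) + x) ` (A \<inter> moved j))"
proof (intro equalityI subsetI)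
  fix y assume y: "y \<in> shift -` A \<inter> {0..<1}"
  then obtain j where j: "j < m" "y \<in> piece j" using pieces_cover by blast
  then have "y + real (b j) \<in> A \<inter> moved j"
    using y shift_piece[OF j] by (auto simp: piece_def moved_def)
  then have "y \<in> (\<lambda>x. - real (b j) + x) ` (A \<inter> moved j)"
    by (intro image_eqI[of _ _ "y + real (b j)"]) auto
  then show "y \<in> (\<Union>j<m. (\<lambda>x. - real (b j) + x) ` (A \<inter> moved j))" using j by blast
next
  fix y assume "y \<in> (\<Union>j<m. (\<lambda>x. - real (b j) + x) ` (A \<inter> moved j))"
  then obtain j where j: "j < m" "y + real (b j) \<in> A \<inter> moved j" by auto
  then have p: "y \<in> piece j" by (auto simp: piece_def moved_def)
  moreover have "y \<in> {0..<1}" using p j(1) pieces_cover by blast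
  ultimately show "y \<in> shift -` A \<inter> {0..<1}" using j shift_piece[OF j(1) p] by auto
qed

lemma shift_measurable: "shift \<in> measurable unit_M (lebesgue_on J)"
proof (rule measurableI)
  fix y assume "y \<in> space unit_M"
  then have "y \<in> {0..<1}" by simp
  then obtain j where j: "j < m" "y \<in> piece j" using pieces_cover by blast
  then have "shift y \<in> moved j" using shift_piece[OF j] by (auto simp: piece_def moved_def)
  then show "shift y \<in> space (lebesgue_on J)" using j by (auto simp: J_def)
next
  fix A assume "A \<in> sets (lebesgue_on J)"
  then have A: "A \<in> sets lebesgue" "A \<subseteq> J"
    using J_sets by (auto simp: sets_restrict_space_iff)
  have "(\<Union>j<m. (\<lambda>x. - real (b j) + x) ` (A \<inter> moved j)) \<in> sets lebesgue"
    by (intro sets.finite_UN lebesgue_sets_translation sets.Int A moved_sets) auto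
  then show "shift -` A \<inter> space unit_M \<in> sets unit_M"
    using shift_vimage[OF A(2)] by (simp add: sets_restrict_space_iff) blast
qed

text \<open>
  Piecewise, the map is a translation, and translations preserve Lebesgue measure.
\<close>

lemma distr_shift: "distr unit_M (lebesgue_on J) shift = lebesgue_on J"
proof (rule measure_eqI)
  fix A assume "A \<in> sets (distr unit_M (lebesgue_on J) shift)"
  then have A': "A \<in> sets (lebesgue_on J)" by simp
  then have A: "A \<in> sets lebesgue" "A \<subseteq> J"
    using J_sets by (auto simp: sets_restrict_space_iff)
  let ?T = "\<lambda>j. (\<lambda>x. - real (b j) + x) ` (A \<inter> moved j)"
  have T: "?T j \<in> sets lebesgue" for j
    by (intro lebesgue_sets_translation sets.Int A moved_sets)
  have T_piece: "?T j \<subseteq> piece j" for j by (auto simp: piece_def moved_def)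
  have disjT: "disjoint_family_on ?T {..<m}"
    unfolding disjoint_family_on_def
  proof (intro ballI impI)
    fix i j assume "i \<in> {..<m}" "j \<in> {..<m}" "i \<noteq> j"
    then have "piece i \<inter> piece j = {}" using piece_unique by blast
    then show "?T i \<inter> ?T j = {}" using T_piece[of i] T_piece[of j] by blast
  qed
  have disjA: "disjoint_family_on (\<lambda>j. A \<inter> moved j) {..<m}"
    unfolding disjoint_family_on_def using moved_unique by blast
  have "emeasure (distr unit_M (lebesgue_on J) shift) A = emeasure unit_M (shift -` A \<inter> {0..<1})"
    using emeasure_distr[OF shift_measurable A'] by simp
  also have "\<dots> = emeasure lebesgue (shift -` A \<inter> {0..<1})"
    by (rule emeasure_restrict_space) auto
  also have "\<dots> = (\<Sum>j<m. emeasure lebesgue (?T j))"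
    unfolding shift_vimage[OF A(2)] using T disjT by (intro sum_emeasure[symmetric]) auto
  also have "\<dots> = (\<Sum>j<m. emeasure lebesgue (A \<inter> moved j))"
  proof (rule sum.cong)
    show "emeasure lebesgue (?T j) = emeasure lebesgue (A \<inter> moved j)" for j
      using emeasure_lebesgue_affine[of 1 "- real (b j)" "A \<inter> moved j"] by (simp add: add.commute)
  qed simp
  also have "\<dots> = emeasure lebesgue (\<Union>j<m. A \<inter> moved j)"
    using A(1) moved_sets disjA by (intro sum_emeasure) auto
  also have "(\<Union>j<m. A \<inter> moved j) = A" using A(2) by (auto simp: J_def)
  also have "emeasure lebesgue A = emeasure (lebesgue_on J) A"
    using A J_sets by (intro emeasure_restrict_space[symmetric]) auto
  finally show "emeasure (distr unit_M (lebesgue_on J) shift) A = emeasure (lebesgue_on J) A" .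
qed simp

lemma space_L2_J_bounded:
  assumes "f \<in> borel_measurable (lebesgue_on J)" "\<And>x. cmod (f x) \<le> C"
  shows "f \<in> space_L2 (lebesgue_on J)"
proof (rule space_L2_bound[where h = "\<lambda>_. C\<^sup>2"])
  interpret finite_measure "lebesgue_on J" by (rule finite_measure_lebesgue_on[OF J_lmeasurable])
  show "integrable (lebesgue_on J) (\<lambda>_. C\<^sup>2)" by simp
  show "(cmod (f x))\<^sup>2 \<le> C\<^sup>2" for x using assms(2) by (intro power_mono) auto
qed (rule assms)

lemma harmonic_shift: "harmonic n (shift y) = harmonic n y"
proof -
  obtain k :: int where "shift y = y + of_int k" using shift_int by blast
  then have "harmonic n (shift y) = harmonic n y * cis (2 * pi * of_int (n * k))"
    by (simp add: harmonic_def cis_mult algebra_simps)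
  also have "cis (2 * pi * of_int (n * k)) = 1" by (rule cis_multiple_2pi) simp
  finally show ?thesis by simp
qed

lemma harmonic_space_J: "harmonic n \<in> space_L2 (lebesgue_on J)"
  by (rule space_L2_J_bounded[of _ 1]) (simp_all add: harmonic_measurable J_sets)

lemma orthonormal_harmonic_J: "orthonormal_L2 (lebesgue_on J) harmonic"
  by (rule pullback_orthonormal[OF shift_measurable distr_shift harmonic_space_J])
    (simp add: harmonic_shift orthonormal_harmonic)

text \<open>
  The harmonics are invariant under integer translations, so their pullbacks to the unit interval are
  the harmonics themselves.
\<close>

lemma parseval_harmonic_J: "parseval_L2 (lebesgue_on J) harmonic"
  by (rule pullback_parseval[OF shift_measurable distr_shift harmonic_space_J])
    (simp add: harmonic_shift parseval_harmonic)

lemma sum_lengths: "(\<Sum>j\<in>{1..<m}. a (Suc j) - a j) \<le> 1"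
proof -
  have "(\<Sum>j\<in>{1..<m}. a (Suc j) - a j) \<le> (\<Sum>j<m. a (Suc j) - a j)"
    using a_step by (intro sum_mono2) (auto intro: less_imp_le)
  also have "\<dots> = 1" by (simp add: sum_lessThan_telescope a_0 a_m)
  finally show ?thesis .
qed

end

section \<open>The exponential system on the moved intervals\<close>

lemma inner_L2_cong:
  assumes "\<And>x. x \<in> space M \<Longrightarrow> f x * cnj (g x) = f' x * cnj (g' x)"
  shows "inner_L2 M f g = inner_L2 M f' g'"
  unfolding inner_L2_def by (rule Bochner_Integration.integral_cong) (use assms in auto)

context interval_exchange
begin

lemma sum_norm_pieces:
  assumes w: "w \<in> space_L2 (lebesgue_on J)"
  shows "(\<Sum>j\<in>{1..<m}. (norm_L2 (lebesgue_on J) (\<lambda>x. w x * indicator (moved j) x))\<^sup>2)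
    \<le> (norm_L2 (lebesgue_on J) w)\<^sup>2"
proof -
  have disj: "disjoint_family_on moved {1..<m}"
    unfolding disjoint_family_on_def using moved_unique by fastforce
  have sq: "(cmod (w x * indicator (moved j) x))\<^sup>2 = (cmod (w x))\<^sup>2 * indicator (moved j) x" for x j
    by (simp add: indicator_def)
  have ind: "(indicator (moved j) :: real \<Rightarrow> complex) \<in> borel_measurable (lebesgue_on J)" for j
    by (intro borel_measurable_lebesgue_on borel_measurable_indicator) (simp add: moved_def)
  have i: "integrable (lebesgue_on J) (\<lambda>x. (cmod (w x))\<^sup>2 * indicator (moved j) x)" for j
    unfolding sq[symmetric]
    by (rule space_L2_integrable, rule space_L2_mult_bounded[OF w ind, of _ 1]) (simp add: indicator_def)
  have "(\<Sum>j\<in>{1..<m}. (norm_L2 (lebesgue_on J) (\<lambda>x. w x * indicator (moved j) x))\<^sup>2)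
      = (LINT x|lebesgue_on J. (\<Sum>j\<in>{1..<m}. (cmod (w x))\<^sup>2 * indicator (moved j) x))"
    unfolding norm_L2_sq sq using i by (intro Bochner_Integration.integral_sum[symmetric])
  also have "\<dots> \<le> (LINT x|lebesgue_on J. (cmod (w x))\<^sup>2)"
  proof (rule integral_mono)
    show "integrable (lebesgue_on J) (\<lambda>x. \<Sum>j\<in>{1..<m}. (cmod (w x))\<^sup>2 * indicator (moved j) x)"
      using i by (intro Bochner_Integration.integrable_sum)
    fix x
    have "(\<Sum>j\<in>{1..<m}. (cmod (w x))\<^sup>2 * indicator (moved j) x)
        = (cmod (w x))\<^sup>2 * indicator (\<Union>j\<in>{1..<m}. moved j) x"
      unfolding indicator_UN_disjoint[OF finite_atLeastLessThan disj] by (rule sum_distrib_left[symmetric])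
    also have "\<dots> \<le> (cmod (w x))\<^sup>2 * 1" by (intro mult_left_mono indicator_le_1) auto
    finally show "(\<Sum>j\<in>{1..<m}. (cmod (w x))\<^sup>2 * indicator (moved j) x) \<le> (cmod (w x))\<^sup>2" by simp
  qed (rule space_L2_integrable[OF w])
  finally show ?thesis unfolding norm_L2_sq .
qed

lemma offset_measurable: "offset \<in> borel_measurable borel"
  unfolding offset_def moved_def by measurable

lemma cis_measurable_J:
  assumes "f \<in> borel_measurable borel"
  shows "(\<lambda>x. cis (f x)) \<in> borel_measurable (lebesgue_on J)"
  by (rule borel_measurable_lebesgue_on, rule borel_measurable_continuous_on[OF _ assms])
    (intro continuous_intros)

text \<open>
  The total perturbation, with \<open>s j\<close> a bound for \<open>\<bar>sin (\<pi> \<delta>\<^sub>n b\<^sub>j)\<bar>\<close> and \<open>K j\<close> Kadec's constant for the length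
  of the \<open>j\<close>th piece. The unimodular factor \<open>exp (\<pi> \<i> \<delta>\<^sub>n)\<close> comes from centring the unit interval
  at \<open>1/2\<close>. The first summand estimates \<open>E n\<close>, the transplanted exponential; the second collects the
  phase jumps \<open>\<mu> n j\<close> between the pieces. The piece \<open>j = 0\<close> is not moved and contributes no jump.
\<close>

lemma exponential_close_to_harmonic:
  fixes \<delta> :: "int \<Rightarrow> real" and s :: "nat \<Rightarrow> real" and L :: real
  defines "K \<equiv> \<lambda>j. 2 - cos (pi * ((a (Suc j) - a j) * L)) + sin (pi * ((a (Suc j) - a j) * L))"
  assumes \<delta>: "\<And>n. \<bar>\<delta> n\<bar> \<le> L" and L: "L \<le> 1/4" and b0: "b 0 = 0"
    and s: "\<And>j n. j \<in> {1..<m} \<Longrightarrow> \<bar>sin (pi * (\<delta> n * real (b j)))\<bar> \<le> s j"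
    and w: "w \<in> space_L2 (lebesgue_on J)" and F: "finite F"
  shows "L2_set (\<lambda>n. cmod (inner_L2 (lebesgue_on J) w (\<lambda>x. cis (2 * pi * (of_int n + \<delta> n) * x))
            - cnj (cis (pi * \<delta> n)) * inner_L2 (lebesgue_on J) w (harmonic n))) F
     \<le> ((1 - cos (pi * L) + sin (pi * L)) + L2_set (\<lambda>j. 2 * s j * K j) {1..<m}) * norm_L2 (lebesgue_on J) w"
proof -
  let ?M = "lebesgue_on J"
  have L0: "0 \<le> L" using \<delta>[of 0] by linarith
  have bes: "bessel_L2 ?M harmonic" by (rule orthonormal_imp_bessel[OF orthonormal_harmonic_J])
  define E where "E n x = harmonic n x * cis (\<delta> n * (2 * pi * (x - offset x)))" for n x
  define \<mu> where "\<mu> n j = cis (2 * pi * (\<delta> n * real (b j))) - 1" for n j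
  define wj where "wj j x = w x * indicator (moved j) x" for j x
  let ?v = "\<lambda>n x. cis (2 * pi * (of_int n + \<delta> n) * x)"
  have ind: "(indicator (moved j) :: real \<Rightarrow> complex) \<in> borel_measurable ?M" for j
    by (intro borel_measurable_lebesgue_on borel_measurable_indicator) (simp add: moved_def)
  have wjs: "wj j \<in> space_L2 ?M" for j
    unfolding wj_def by (rule space_L2_mult_bounded[OF w ind, of _ 1]) (simp add: indicator_def)
  have Es: "E n \<in> space_L2 ?M" for n
    unfolding E_def
  proof (rule space_L2_mult_bounded[OF harmonic_space_J cis_measurable_J])
    show "(\<lambda>x. \<delta> n * (2 * pi * (x - offset x))) \<in> borel_measurable borel"
      using offset_measurable by measurable
    show "cmod (cis (\<delta> n * (2 * pi * (x - offset x)))) \<le> 1" for x by simp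
  qed
  have iEs: "(\<lambda>x. indicator (moved j) x * E n x) \<in> space_L2 ?M" for n j
    unfolding mult.commute[of "indicator (moved j) _"]
    by (rule space_L2_mult_bounded[OF Es ind, of _ 1]) (simp add: indicator_def)

  have decomp: "inner_L2 ?M w (?v n) = inner_L2 ?M w (E n) + (\<Sum>j\<in>{1..<m}. cnj (\<mu> n j) * inner_L2 ?M (wj j) (E n))" for n
  proof -
    have "?v n x = E n x + (\<Sum>j\<in>{1..<m}. \<mu> n j * (indicator (moved j) x * E n x))" if "x \<in> J" for x
    proof -
      obtain i where i: "i < m" "x \<in> moved i" using \<open>x \<in> J\<close> by (auto simp: J_def)
      have "(\<Sum>j\<in>{1..<m}. \<mu> n j * (indicator (moved j) x * E n x))
          = (\<Sum>j\<in>{1..<m}. if j = i then \<mu> n i * E n x else 0)"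
      proof (rule sum.cong)
        fix j assume j: "j \<in> {1..<m}"
        show "\<mu> n j * (indicator (moved j) x * E n x) = (if j = i then \<mu> n i * E n x else 0)"
        proof (cases "j = i")
          case False
          then have "x \<notin> moved j" using moved_unique i j by fastforce
          then show ?thesis using False by simp
        qed (use i in simp)
      qed simp
      also have "\<dots> = \<mu> n i * E n x"
        using i b0 by (cases "i = 0") (auto simp: \<mu>_def)
      also have "E n x + \<mu> n i * E n x = cis (2 * pi * (\<delta> n * real (b i))) * E n x"
        by (simp add: \<mu>_def algebra_simps)
      also have "\<dots> = ?v n x"
        unfolding E_def harmonic_def offset_moved[OF i] by (simp add: cis_mult algebra_simps)
      finally show ?thesis by simp
    qed
    then have "inner_L2 ?M w (?v n)
        = inner_L2 ?M w (\<lambda>x. E n x + (\<Sum>j\<in>{1..<m}. \<mu> n j * (indicator (moved j) x * E n x)))"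
      by (intro inner_L2_cong) simp
    also have "\<dots> = inner_L2 ?M w (E n)
        + (\<Sum>j\<in>{1..<m}. cnj (\<mu> n j) * inner_L2 ?M w (\<lambda>x. indicator (moved j) x * E n x))"
      by (simp add: inner_L2_add_right inner_L2_sum_right inner_L2_cmult_right
          space_L2_sum space_L2_cmult Es iEs w)
    also have "(\<lambda>j. inner_L2 ?M w (\<lambda>x. indicator (moved j) x * E n x)) = (\<lambda>j. inner_L2 ?M (wj j) (E n))"
      by (intro ext inner_L2_cong) (simp add: wj_def indicator_def)
    finally show ?thesis .
  qed

  \<comment> \<open>Kadec on the whole of \<open>[0,1)\<close>, with centre \<open>1/2\<close>.\<close>
  have centre: "L2_set (\<lambda>n. cmod (inner_L2 ?M w (E n) - cnj (cis (pi * \<delta> n)) * inner_L2 ?M w (harmonic n))) F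
      \<le> (1 - cos (pi * L) + sin (pi * L)) * norm_L2 ?M w"
  proof -
    define t where "t x = 2 * pi * (x - offset x - 1/2)" for x
    have tm: "t \<in> borel_measurable borel" unfolding t_def using offset_measurable by measurable
    have tb: "\<bar>t x\<bar> \<le> pi" if x: "x \<in> space ?M" for x
    proof -
      obtain i where i: "i < m" "x \<in> moved i" using x by (auto simp: J_def)
      have "0 \<le> a i" "a (Suc i) \<le> 1" using a_mono[of 0 i] a_mono[of "Suc i" m] i a_0 a_m by auto
      then have "\<bar>x - offset x - 1/2\<bar> \<le> 1/2"
        using i(2) unfolding offset_moved[OF i] moved_def atLeastLessThan_iff by linarith
      then have "2 * pi * \<bar>x - offset x - 1/2\<bar> \<le> 2 * pi * (1/2)" by (intro mult_left_mono) auto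
      then show ?thesis by (simp add: t_def abs_mult)
    qed
    have cm: "(\<lambda>x. 1 - cis (\<delta> n * t x)) \<in> borel_measurable ?M" for n
      by (intro borel_measurable_diff cis_measurable_J) (use tm in simp_all)
    have ds: "(\<lambda>x. harmonic n x * (1 - cis (\<delta> n * t x))) \<in> space_L2 ?M" for n
    proof (rule space_L2_mult_bounded[OF harmonic_space_J cm])
      show "cmod (1 - cis (\<delta> n * t x)) \<le> 2" for x
        using norm_triangle_ineq4[of 1 "cis (\<delta> n * t x)"] by simp
    qed
    have "inner_L2 ?M w (E n) - cnj (cis (pi * \<delta> n)) * inner_L2 ?M w (harmonic n)
        = - cnj (cis (pi * \<delta> n)) * inner_L2 ?M w (\<lambda>x. harmonic n x * (1 - cis (\<delta> n * t x)))" for n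
    proof -
      have "E n x = cis (pi * \<delta> n) * (harmonic n x - harmonic n x * (1 - cis (\<delta> n * t x)))" for x
      proof -
        have "cis (\<delta> n * (2 * pi * (x - offset x))) = cis (pi * \<delta> n) * cis (\<delta> n * t x)"
          unfolding cis_mult by (rule arg_cong[of _ _ cis]) (simp add: t_def algebra_simps)
        then show ?thesis by (simp add: E_def right_diff_distrib)
      qed
      then have En: "E n = (\<lambda>x. cis (pi * \<delta> n) * (harmonic n x - harmonic n x * (1 - cis (\<delta> n * t x))))"
        by (rule ext)
      have "inner_L2 ?M w (E n) = cnj (cis (pi * \<delta> n)) *
         (inner_L2 ?M w (harmonic n) - inner_L2 ?M w (\<lambda>x. harmonic n x * (1 - cis (\<delta> n * t x))))"
        unfolding En inner_L2_cmult_right inner_L2_diff_right[OF harmonic_space_J ds w] ..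
      then show ?thesis by (simp add: algebra_simps)
    qed
    then have "L2_set (\<lambda>n. cmod (inner_L2 ?M w (E n) - cnj (cis (pi * \<delta> n)) * inner_L2 ?M w (harmonic n))) F
       = L2_set (\<lambda>n. cmod (inner_L2 ?M w (\<lambda>x. harmonic n x * (1 - cis (\<delta> n * t x))))) F"
      by (simp add: norm_mult)
    also have "\<dots> \<le> (1 - cos (pi * L) + sin (pi * L)) * norm_L2 ?M w"
      by (rule Kadec_estimate[OF bes w borel_measurable_lebesgue_on[OF tm] tb \<delta> L F])
    finally show ?thesis .
  qed

  have piece_bound: "L2_set (\<lambda>n. cmod (cnj (\<mu> n j) * inner_L2 ?M (wj j) (E n))) F
      \<le> 2 * s j * K j * norm_L2 ?M (wj j)" if j: "j \<in> {1..<m}" for j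
  proof -
    define l where "l = a (Suc j) - a j"
    define c where "c = (a j + a (Suc j)) / 2"
    define t where "t x = indicator (moved j) x * (2 * pi * (x - real (b j) - c) / l)" for x
    have l: "0 < l" "l \<le> 1"
      using a_step[of j] j a_mono[of 0 j] a_mono[of "Suc j" m] a_0 a_m by (auto simp: l_def)
    have tm: "t \<in> borel_measurable borel" unfolding t_def moved_def by measurable
    \<comment> \<open>The phase is centred at the midpoint of the piece and stretched to fill \<open>[-\<pi>, \<pi>]\<close>; in return \<open>\<delta> n\<close> shrinks by the length \<open>l\<close>.\<close>
    have tb: "\<bar>t x\<bar> \<le> pi" for x
    proof (cases "x \<in> moved j")
      case True
      then have "\<bar>x - real (b j) - c\<bar> \<le> l / 2"
        by (auto simp: moved_def c_def l_def abs_le_iff field_simps)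
      then have "2 * pi * \<bar>x - real (b j) - c\<bar> / l \<le> 2 * pi * (l / 2) / l"
        using l by (intro divide_right_mono mult_left_mono) auto
      then show ?thesis using True l by (simp add: t_def abs_mult abs_divide)
    qed (simp add: t_def)
    have \<delta>l: "\<bar>\<delta> n * l\<bar> \<le> l * L" for n
      using mult_right_mono[OF \<delta>[of n], of l] l by (simp add: abs_mult mult.commute)
    have lL: "l * L \<le> 1/4" using mult_mono[OF l(2) L] L0 l by simp
    have K: "2 - cos (pi * (l * L)) + sin (pi * (l * L)) = K j" by (simp add: K_def l_def)
    have "inner_L2 ?M (wj j) (E n) = cnj (cis (\<delta> n * (2 * pi * c))) *
        inner_L2 ?M (wj j) (\<lambda>x. harmonic n x * cis ((\<delta> n * l) * t x))" for n
      unfolding inner_L2_cmult_right[symmetric]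
    proof (rule inner_L2_cong)
      fix x
      have "E n x = cis (\<delta> n * (2 * pi * c)) * (harmonic n x * cis ((\<delta> n * l) * t x))" if "x \<in> moved j"
      proof -
        have "(\<delta> n * l) * t x = \<delta> n * (2 * pi * (x - real (b j) - c))"
          using that l by (simp add: t_def)
        then have "\<delta> n * (2 * pi * (x - real (b j))) = \<delta> n * (2 * pi * c) + (\<delta> n * l) * t x"
          by (simp add: algebra_simps)
        then have "cis (\<delta> n * (2 * pi * (x - real (b j)))) = cis (\<delta> n * (2 * pi * c)) * cis ((\<delta> n * l) * t x)"
          by (simp only: cis_mult)
        moreover have "offset x = real (b j)" using j that by (intro offset_moved) auto
        ultimately show ?thesis unfolding E_def by (simp only: mult_ac)
      qed
      then show "wj j x * cnj (E n x)
         = wj j x * cnj (cis (\<delta> n * (2 * pi * c)) * (harmonic n x * cis ((\<delta> n * l) * t x)))"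
        by (cases "x \<in> moved j") (simp_all add: wj_def)
    qed
    then have "L2_set (\<lambda>n. cmod (inner_L2 ?M (wj j) (E n))) F
        = L2_set (\<lambda>n. cmod (inner_L2 ?M (wj j) (\<lambda>x. harmonic n x * cis ((\<delta> n * l) * t x)))) F"
      by (simp add: norm_mult)
    also have "\<dots> \<le> K j * norm_L2 ?M (wj j)"
      using Kadec_upper_estimate[OF bes wjs borel_measurable_lebesgue_on[OF tm] tb \<delta>l lL F] unfolding K .
    finally have E_bound: "L2_set (\<lambda>n. cmod (inner_L2 ?M (wj j) (E n))) F \<le> K j * norm_L2 ?M (wj j)" .
    have \<mu>b: "cmod (\<mu> n j) \<le> 2 * s j" for n
    proof -
      let ?y = "pi * (\<delta> n * real (b j))"
      have "\<mu> n j = cis ?y * (cis ?y - cis (- ?y))"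
        by (simp add: \<mu>_def right_diff_distrib cis_mult algebra_simps)
      moreover have "cis ?y - cis (- ?y) = 2 * \<i> * of_real (sin ?y)" by (simp add: complex_eq_iff)
      ultimately have "cmod (\<mu> n j) = 2 * \<bar>sin ?y\<bar>" by (simp add: norm_mult)
      then show ?thesis using s[OF j, of n] by simp
    qed
    have s0: "0 \<le> s j" using s[OF j, of 0] by linarith
    have "L2_set (\<lambda>n. cmod (cnj (\<mu> n j) * inner_L2 ?M (wj j) (E n))) F
        \<le> L2_set (\<lambda>n. 2 * s j * cmod (inner_L2 ?M (wj j) (E n))) F"
      using \<mu>b by (intro L2_set_mono) (auto simp: norm_mult intro: mult_right_mono)
    also have "\<dots> = 2 * s j * L2_set (\<lambda>n. cmod (inner_L2 ?M (wj j) (E n))) F"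
      using s0 by (intro L2_set_right_distrib[symmetric]) simp
    also have "\<dots> \<le> 2 * s j * (K j * norm_L2 ?M (wj j))"
      using s0 E_bound by (intro mult_left_mono) auto
    finally show ?thesis by (simp add: mult.assoc)
  qed

  \<comment> \<open>The Cauchy--Schwarz inequality over the pieces, on which the norms of \<open>w\<close> add up in square.\<close>
  have pieces: "L2_set (\<lambda>n. cmod (\<Sum>j\<in>{1..<m}. cnj (\<mu> n j) * inner_L2 ?M (wj j) (E n))) F
      \<le> L2_set (\<lambda>j. 2 * s j * K j) {1..<m} * norm_L2 ?M w"
  proof -
    have "L2_set (\<lambda>n. cmod (\<Sum>j\<in>{1..<m}. cnj (\<mu> n j) * inner_L2 ?M (wj j) (E n))) F
        \<le> (\<Sum>j\<in>{1..<m}. \<bar>2 * s j * K j\<bar> * \<bar>norm_L2 ?M (wj j)\<bar>)"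
    proof (rule order_trans[OF L2_set_cmod_sum sum_mono])
      fix j assume "j \<in> {1..<m}"
      from piece_bound[OF this]
      show "L2_set (\<lambda>n. cmod (cnj (\<mu> n j) * inner_L2 ?M (wj j) (E n))) F
          \<le> \<bar>2 * s j * K j\<bar> * \<bar>norm_L2 ?M (wj j)\<bar>"
        unfolding abs_mult[symmetric] by linarith
    qed
    also have "\<dots> \<le> L2_set (\<lambda>j. 2 * s j * K j) {1..<m} * L2_set (\<lambda>j. norm_L2 ?M (wj j)) {1..<m}"
      by (rule L2_set_mult_ineq)
    also have "L2_set (\<lambda>j. norm_L2 ?M (wj j)) {1..<m} \<le> norm_L2 ?M w"
      unfolding L2_set_def wj_def using sum_norm_pieces[OF w]
      by (intro real_le_lsqrt) auto
    finally show ?thesis by (simp add: mult_left_mono)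
  qed

  have "L2_set (\<lambda>n. cmod (inner_L2 ?M w (?v n) - cnj (cis (pi * \<delta> n)) * inner_L2 ?M w (harmonic n))) F
      = L2_set (\<lambda>n. cmod ((inner_L2 ?M w (E n) - cnj (cis (pi * \<delta> n)) * inner_L2 ?M w (harmonic n))
         + (\<Sum>j\<in>{1..<m}. cnj (\<mu> n j) * inner_L2 ?M (wj j) (E n)))) F"
    unfolding decomp by (simp add: algebra_simps)
  also have "\<dots> \<le> (1 - cos (pi * L) + sin (pi * L)) * norm_L2 ?M w
      + L2_set (\<lambda>j. 2 * s j * K j) {1..<m} * norm_L2 ?M w"
    by (rule order_trans[OF L2_set_cmod_add add_mono[OF centre pieces]])
  finally show ?thesis by (simp add: distrib_right)
qed

end

lemma abs_sin_infdist_Ints: "\<bar>sin (pi * infdist x \<int>)\<bar> = \<bar>sin (pi * x)\<bar>"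
proof -
  obtain k :: int where k: "infdist x \<int> = \<bar>x - of_int k\<bar>" using infdist_Ints_attained by blast
  have "\<bar>sin (pi * \<bar>y\<bar>)\<bar> = \<bar>sin (pi * y)\<bar>" for y :: real by (cases "y \<ge> 0") simp_all
  then have "\<bar>sin (pi * \<bar>x - of_int k\<bar>)\<bar> = \<bar>sin (pi * (x - of_int k))\<bar>" .
  also have "sin (pi * (x - of_int k)) = sin (pi * x) * cos (pi * of_int k)"
    by (simp add: right_diff_distrib sin_diff)
  also have "\<bar>\<dots>\<bar> = \<bar>sin (pi * x)\<bar>" by (simp add: abs_mult cos_npi_int)
  finally show ?thesis by (simp add: k)
qed

theorem theorem4p1:
  fixes m :: nat and a :: "nat \<Rightarrow> real" and b :: "nat \<Rightarrow> nat"
    and J :: "real set" and \<gamma> :: "nat \<Rightarrow> real"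
    and \<delta> :: "int \<Rightarrow> real" and L A :: real and B :: "real \<Rightarrow> real"
  assumes "m \<ge> 2"
    and "a 0 = 0" and "a m = 1" and "\<And>j. j < m \<Longrightarrow> a j < a (Suc j)"
    and "b 0 = 0" and "\<And>j. Suc j < m \<Longrightarrow> b j < b (Suc j)"
    and "J = (\<Union>j<m. {a j + real (b j) ..< a (Suc j) + real (b j)})"
    and "\<And>j. \<gamma> j = (a (Suc j) - a j) / 2"
    and "bdd_above (range (\<lambda>n. \<bar>\<delta> n\<bar>))" and "L = (SUP n. \<bar>\<delta> n\<bar>)" and "L < 1/4"
    and "A = cos (pi * L) - sin (pi * L)"
    and "\<And>g. B g = 2 - cos (pi * g * L) + sin (pi * g * L)"
    and "Max ((\<lambda>j. B (\<gamma> j) * (SUP n. \<bar>sin (pi * infdist (\<delta> n * real (b j)) \<int>)\<bar>)) ` {1..m - 1})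
           < A / (2 * sqrt (real m))"
  shows "riesz_basis_L2 (lebesgue_on J)
           (\<lambda>n x. exp (2 * complex_of_real pi * \<i> * complex_of_real ((real_of_int n + \<delta> n) * x)))"
proof -
  interpret X: interval_exchange m a b
    using assms(2-4,6) by unfold_locales (auto intro: less_imp_le)
  have J: "J = X.J" using assms(7) by (simp add: X.J_def X.moved_def)
  have \<delta>: "\<bar>\<delta> n\<bar> \<le> L" for n unfolding assms(10) using assms(9) by (intro cSUP_upper) auto
  have L0: "0 \<le> L" using \<delta>[of 0] by linarith
  define s where "s j = (SUP n. \<bar>sin (pi * infdist (\<delta> n * real (b j)) \<int>)\<bar>)" for j
  have s: "\<bar>sin (pi * (\<delta> n * real (b j)))\<bar> \<le> s j" for n j
  proof -
    have "\<bar>sin (pi * infdist (\<delta> n * real (b j)) \<int>)\<bar> \<le> s j"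
      unfolding s_def by (rule cSUP_upper) (auto intro!: bdd_aboveI2[of _ _ 1])
    then show ?thesis by (simp only: abs_sin_infdist_Ints)
  qed
  have s0: "0 \<le> s j" for j using s[of 0 j] by linarith
  define Z where "Z = Max ((\<lambda>j. B (\<gamma> j) * s j) ` {1..m - 1})"
  have Z: "Z < A / (2 * sqrt (real m))" using assms(14) by (simp add: Z_def s_def)
  have BZ: "B (\<gamma> j) * s j \<le> Z" if "j \<in> {1..<m}" for j
    unfolding Z_def using that by (intro Max_ge) auto
  have l: "0 < a (Suc j) - a j" "a (Suc j) - a j \<le> 1" if "j < m" for j
    using X.a_step[OF that] X.a_mono[of 0 j] X.a_mono[of "Suc j" m] that assms(2,3) by auto
  define K where "K j = 2 - cos (pi * ((a (Suc j) - a j) * L)) + sin (pi * ((a (Suc j) - a j) * L))" for j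
  have KB: "(K j)\<^sup>2 \<le> (1 + (a (Suc j) - a j)) * (B (\<gamma> j))\<^sup>2" if "j < m" for j
  proof -
    have g: "2 * \<gamma> j = a (Suc j) - a j" by (simp add: assms(8))
    show ?thesis unfolding K_def assms(13)
      by (rule Kadec_constant_half_length[of "\<gamma> j" L, unfolded g])
        (use l[OF that] L0 assms(11) g in linarith)+
  qed
  have B0: "0 \<le> B g" for g
    unfolding assms(13) using cos_le_one[of "pi * g * L"] sin_ge_minus_one[of "pi * g * L"] by linarith
  have Z0: "0 \<le> Z"
    using BZ[of 1] assms(1) mult_nonneg_nonneg[OF B0 s0, of "\<gamma> 1" 1] by auto
  define \<theta> where "\<theta> = L2_set (\<lambda>j. 2 * s j * K j) {1..<m}"
  \<comment> \<open>Each factor \<open>1 + (a (Suc j) - a j)\<close> is the price for replacing \<open>K j\<close> by \<open>B (\<gamma> j)\<close>; the lengths sum up to at most \<open>1\<close>, the share of the absent index \<open>0\<close>.\<close>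
  have "\<theta> \<le> 2 * Z * sqrt (real m)"
  proof -
    have "\<theta>\<^sup>2 = (\<Sum>j\<in>{1..<m}. (2 * s j * K j)\<^sup>2)" by (simp add: \<theta>_def L2_set_def sum_nonneg)
    also have "\<dots> \<le> (\<Sum>j\<in>{1..<m}. 4 * Z\<^sup>2 * (1 + (a (Suc j) - a j)))"
    proof (rule sum_mono)
      fix j assume j: "j \<in> {1..<m}"
      have "(2 * s j * K j)\<^sup>2 = 4 * (s j)\<^sup>2 * (K j)\<^sup>2" by (simp add: power_mult_distrib)
      also have "\<dots> \<le> 4 * (s j)\<^sup>2 * ((1 + (a (Suc j) - a j)) * (B (\<gamma> j))\<^sup>2)"
        using KB[of j] j by (intro mult_left_mono) auto
      also have "\<dots> = 4 * (B (\<gamma> j) * s j)\<^sup>2 * (1 + (a (Suc j) - a j))"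
        by (simp add: power_mult_distrib)
      also have "\<dots> \<le> 4 * Z\<^sup>2 * (1 + (a (Suc j) - a j))"
        using BZ[OF j] l[of j] j B0 s0 by (intro mult_right_mono mult_left_mono power_mono) auto
      finally show "(2 * s j * K j)\<^sup>2 \<le> 4 * Z\<^sup>2 * (1 + (a (Suc j) - a j))" .
    qed
    also have "\<dots> = 4 * Z\<^sup>2 * (real (m - 1) + (\<Sum>j\<in>{1..<m}. a (Suc j) - a j))"
      by (simp add: sum_distrib_left[symmetric] sum.distrib)
    also have "\<dots> \<le> 4 * Z\<^sup>2 * real m"
      using X.sum_lengths assms(1) by (intro mult_left_mono) (auto simp: of_nat_diff)
    also have "\<dots> = (2 * Z * sqrt (real m))\<^sup>2" by (simp add: power_mult_distrib)
    finally show ?thesis by (rule power2_le_imp_le) (use Z0 in simp)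
  qed
  also have "\<dots> < A"
    using Z assms(1) by (simp add: field_simps)
  finally have \<theta>: "\<theta> < A" .
  have \<theta>0: "0 \<le> \<theta>" by (simp add: \<theta>_def)
  let ?v = "\<lambda>n x. cis (2 * pi * (of_int n + \<delta> n) * x)"
  have "riesz_basis_L2 (lebesgue_on X.J) ?v"
  proof (rule Paley_Wiener_riesz_basis[OF X.orthonormal_harmonic_J X.parseval_harmonic_J])
    show "?v n \<in> space_L2 (lebesgue_on X.J)" for n
      by (rule X.space_L2_J_bounded[of _ 1], rule X.cis_measurable_J) simp_all
    show "cmod (cnj (cis (pi * \<delta> n))) = 1" for n by simp
    have "A \<le> 1"
    proof -
      have "0 \<le> sin (pi * L)"
        using L0 assms(11) mult_left_mono[of L 1 pi] by (intro sin_ge_zero) auto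
      then show ?thesis using cos_le_one[of "pi * L"] unfolding assms(12) by linarith
    qed
    then show "0 \<le> (1 - A) + \<theta>" "(1 - A) + \<theta> < 1" using \<theta> \<theta>0 by auto
    have A1: "1 - A = 1 - cos (pi * L) + sin (pi * L)" by (simp add: assms(12))
    fix w F assume "w \<in> space_L2 (lebesgue_on X.J)" "finite (F :: int set)"
    then show "L2_set (\<lambda>n. cmod (inner_L2 (lebesgue_on X.J) w (?v n)
        - cnj (cis (pi * \<delta> n)) * inner_L2 (lebesgue_on X.J) w (harmonic n))) F
       \<le> ((1 - A) + \<theta>) * norm_L2 (lebesgue_on X.J) w"
      using X.exponential_close_to_harmonic[of \<delta> L s w F] \<delta> s assms(5,11)
      unfolding A1 \<theta>_def K_def by simp
  qed
  moreover have "exp (2 * complex_of_real pi * \<i> * complex_of_real ((real_of_int n + \<delta> n) * x)) = ?v n x" for n x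
    by (simp add: cis_conv_exp mult_ac)
  ultimately show ?thesis unfolding J by simp
qed

end
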